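(* Let $A\in\mathbb{N}_+$ and let $T=(V,E)$ be a tree growing at an exponential rate $A$. For each $v\in V$ let $Z_v$ be a real-valued random variable, all defined on a common probability space $(\Omega,\mathcal{A},\mathbb{P})$, with $\mathbb{E}[Z_v]=0$, $\|Z_v\|_\infty\le C$ and $\mathrm{Var}(Z_v)\le\sigma^2$ for some constants $0<\sigma,C<\infty$ not depending on $v$. Let $L\in\mathbb{N}$, $P\in\mathbb{N}_+$ and consider the set of nodes $$V' := V(L,1,P)\cup\ldots\cup V(L,A^L,P).$$ Let $Q_2,P_2\in\mathbb{N}_+$ be such that $Q_2\le P_2$ and $P_2+Q_2<A^L$, let $\beta$ satisfy $$0<\beta\le\frac{A-1}{4e\,C\,P_2\,(A^P-1)},$$ and put $f:=2\left\lceil \frac{\log Q_2}{\log A}\right\rceil$. Then for every $\epsilon>0$ $$\mathbb{P}\left(\left|\sum_{v\in V'}Z_v\right|>\epsilon\right)\le 2e^{-\beta\epsilon}\exp\left\{10\sqrt{e}\;\alpha_T(f)^{(P_2+Q_2)/(2P_2+2Q_2+A^L)}\,\frac{A^L}{P_2+Q_2}\right\}$$ $$\qquad\cdot\exp\left\{4\beta^2e\,(P_2)^2\left(\frac{A^P-1}{A-1}\sigma^2+4C^2\sum_{k=1}^{2(P-1)}\alpha_T(k)\,N(P,k)\right)\left(\frac{A^L}{P_2+Q_2}+1\right)\right\}.$$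
   Context: $\mathbb{N}=\{0,1,2,\ldots\}$, $\mathbb{N}_+=\{1,2,\ldots\}$; $a\vee b=\max(a,b)$, $a\wedge b=\min(a,b)$; $1_{\{\cdot\}}$ denotes an indicator. Tree growing at an exponential rate $A\in\mathbb{N}_+$: the rooted tree $T=(V,E)$ in which each node has exactly $A$ children, with nodes labeled $V=\{(j,k): j\in\mathbb{N},\,1\le k\le A^j\}$ and edges $E=\{((j,k),(j+1,k')): (j,k)\in V,\ A(k-1)+1\le k'\le Ak\}$, i.e. the root is $(0,1)$ and the children of $(j,k)$ are $(j+1,A(k-1)+1),\ldots,(j+1,Ak)$. Graph metric: $d_T(v,w)$ is the minimal number of edges of a path joining $v$ and $w$ (edges regarded as undirected), and for $I,J\subseteq V$, $d_T(I,J)=\inf\{d_T(v,w):v\in I,w\in J\}$. Mixing coefficient: for $I\subseteq V$ let $\mathcal{F}(I)=\sigma(Z_v:v\in I)$. For $n\in\mathbb{N}$, $$\alpha_T(n)=\sup_{I,J\subseteq V,\ d_T(I,J)\ge n}\ \sup_{A'\in\mathcal{F}(I),\,B'\in\mathcal{F}(J)}|\mathbb{P}(A'\cap B')-\mathbb{P}(A')\mathbb{P}(B')|.$$ Subtrees: $V(j,k,P)=\{(j',k')\in V:\ j\le j'\le j+P-1,\ A^{j'-j}(k-1)+1\le k'\le A^{j'-j}k\}$ is the set of nodes of the subtree rooted at $(j,k)$ consisting of $P$ generations. Pair counts: for $1\le k\le 2(P-1)$, $N(P,k)$ denotes the number of ordered pairs of nodes of $V(j,i,P)$ at distance exactly $k$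 (this does not depend on $(j,i)$); explicitly $$N(P,k)=\sum_{h=0}^{\lfloor P-1-k/2\rfloor}A^h\sum_{i=1\vee(k-(P-1-h))}^{k\wedge(P-1-h)}A^i\left(2\cdot 1_{\{k=i\}}+(A-1)A^{k-i-1}1_{\{k>i\}}\right).$$ *)

theory Defs
  imports "HOL-Probability.Probability"
begin

definition nodes :: "nat \<Rightarrow> (nat \<times> nat) set" where
  "nodes A = {(j, k). 1 \<le> k \<and> k \<le> A ^ j}"

definition edges :: "nat \<Rightarrow> ((nat \<times> nat) \<times> (nat \<times> nat)) set" where
  "edges A = {((j, k), (j + 1, k')) | j k k'.
     (j, k) \<in> nodes A \<and> A * (k - 1) + 1 \<le> k' \<and> k' \<le> A * k}"

text \<open>Edges are directed from parent to child; a path may traverse them either way.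
  It is represented by the list of its vertices.\<close>

definition paths :: "nat \<Rightarrow> nat \<times> nat \<Rightarrow> nat \<times> nat \<Rightarrow> (nat \<times> nat) list set" where
  "paths A v w = {p. p \<noteq> [] \<and> hd p = v \<and> last p = w \<and> set p \<subseteq> nodes A \<and> distinct p \<and>
     successively (\<lambda>x y. (x, y) \<in> edges A \<or> (y, x) \<in> edges A) p}"

definition tree_dist :: "nat \<Rightarrow> nat \<times> nat \<Rightarrow> nat \<times> nat \<Rightarrow> enat" where
  "tree_dist A v w = (INF p\<in>paths A v w. enat (length p - 1))"

text \<open>In \<^typ>\<open>enat\<close> the infimum over the empty set is \<open>\<infinity>\<close>.\<close>

definition tree_setdist :: "nat \<Rightarrow> (nat \<times> nat) set \<Rightarrow> (nat \<times> nat) set \<Rightarrow> enat" where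
  "tree_setdist A I J = (INF (v, w)\<in>I \<times> J. tree_dist A v w)"

definition gen_sigma :: "'a measure \<Rightarrow> ('v \<Rightarrow> 'a \<Rightarrow> real) \<Rightarrow> 'v set \<Rightarrow> 'a set set" where
  "gen_sigma M Z I =
     sigma_sets (space M) (\<Union>v\<in>I. {Z v -` S \<inter> space M | S. S \<in> sets borel})"

text \<open>For a probability measure \<open>M\<close> and measurable \<open>Z\<close>, both suprema are over nonempty sets of
  reals in \<open>[0, 1]\<close>: the pair \<open>({}, {})\<close> is always admissible for \<open>(I, J)\<close>, and
  \<open>gen_sigma M Z I\<close> always contains \<open>{}\<close>.\<close>

definition mixing_coeff :: "nat \<Rightarrow> 'a measure \<Rightarrow> (nat \<times> nat \<Rightarrow> 'a \<Rightarrow> real) \<Rightarrow> nat \<Rightarrow> real" where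
  "mixing_coeff A M Z n =
     (SUP (I, J)\<in>{(I, J). I \<subseteq> nodes A \<and> J \<subseteq> nodes A \<and> enat n \<le> tree_setdist A I J}.
      SUP (S, S')\<in>gen_sigma M Z I \<times> gen_sigma M Z J.
        \<bar>measure M (S \<inter> S') - measure M S * measure M S'\<bar>)"

definition subtree :: "nat \<Rightarrow> nat \<Rightarrow> nat \<Rightarrow> nat \<Rightarrow> (nat \<times> nat) set" where
  "subtree A j k P = {(j', k') \<in> nodes A. j \<le> j' \<and> j' \<le> j + P - 1 \<and>
     A ^ (j' - j) * (k - 1) + 1 \<le> k' \<and> k' \<le> A ^ (j' - j) * k}"

text \<open>Ordered pairs at distance exactly \<open>k\<close>.  The count is the same in every \<open>subtree A j i P\<close> with
  \<open>(j, i) \<in> nodes A\<close>, so the subtree at the root is used.\<close>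

definition pair_count :: "nat \<Rightarrow> nat \<Rightarrow> nat \<Rightarrow> nat" where
  "pair_count A P k =
     card {(v, w) \<in> subtree A 0 1 P \<times> subtree A 0 1 P. tree_dist A v w = enat k}"

end

theory Submission imports Defs
begin

text \<open>The probability is bounded by Markov's inequality for the exponentials of \<open>\<beta>\<close> and \<open>- \<beta>\<close> times
the sum, so everything rests on an exponential moment bound (\<open>Bernstein_inequality\<close>).

The \<open>A ^ L\<close> subtrees rooted in generation \<open>L\<close> are grouped alternately into blocks of
\<open>P2\<close> and of \<open>Q2\<close> neighbouring subtrees.  Two blocks of the same kind are separated by at least
\<open>Q2\<close> subtrees.  A common ancestor of a node of one and a node of the other then lies at least
\<open>f / 2\<close> generations above generation \<open>L\<close>, since \<open>h\<close> generations above it a node has only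
\<open>A ^ h\<close> descendants in generation \<open>L\<close>.  Hence the distance of two such blocks is at least \<open>f\<close>
(\<open>subtrees_far_apart\<close>).  The sums over blocks of one kind are therefore nearly independent, with
mixing coefficient \<open>\<alpha>\<close> at distance \<open>f\<close>.

Let \<open>X 0, ..., X (R - 1)\<close> be these block sums, scaled so that they are bounded by \<open>1 / 2\<close>.  A
single one satisfies \<open>E (exp X) \<le> 1 + E X\<^sup>2 \<le> exp (E X\<^sup>2)\<close>.  The exponential moment of the whole
sum is compared with the product of these moments one block at a time
(\<open>exp_moment_weakly_dependent_sum\<close>).  Each comparison is an application of the covariance
inequality \<open>\<bar>cov U V\<bar> \<le> 4 * \<alpha> * sup \<bar>U\<bar> * sup \<bar>V\<bar>\<close> (\<open>covariance_strong_mixing_bound\<close>).  The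
supremum of the exponential of \<open>j\<close> blocks is only bounded by \<open>exp (j / 2)\<close>.  This is why \<open>\<alpha>\<close> enters
through its \<open>(R + 1)\<close>-th root \<open>g\<close>: one factor \<open>g\<close> compensates the exponential growth per block and
one is left over.  If \<open>g\<close> is too large to compensate, the assertion follows from the bound
\<open>1 / 2\<close> alone.  Since the exponential moment of a centred variable is at least 1, the error is a
factor \<open>exp (10 * sqrt e * g)\<close> per step.

The second moment of a block is reduced to that of a single subtree
(\<open>subtree_sum_second_moment\<close>), whose off-diagonal terms are grouped by distance.  The pair counts
refer to the subtree at the root, while the covariances live in a subtree below \<open>(L, k)\<close>.  To
compare them only one inequality is needed: moving two nodes from the root subtree to the other
one does not decrease their distance, because the tree retracts onto the descendants of \<open>(L, k)\<close>
without stretching edges (\<open>tree_dist_embed_ge\<close>).\<close>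

section \<open>Covariances of bounded variables over two sub-sigma-algebras\<close>

lemma (in prob_space) integrable_AE_bounded:
  fixes f :: "'a \<Rightarrow> real"
  assumes "f \<in> borel_measurable M" "AE x in M. \<bar>f x\<bar> \<le> B"
  shows "integrable M f"
  using assms by (intro integrable_const_bound[where B = B]) auto

text \<open>The covariance of \<open>U\<close> and \<open>V\<close> is the integral of \<open>U\<close> against
\<open>W = E[V | F] - E V\<close>, so it is at most \<open>a * E \<bar>W\<bar>\<close>.  As \<open>W\<close> has mean zero,
\<open>E \<bar>W\<bar>\<close> is twice the integral of \<open>W\<close> over \<open>{W > 0}\<close>; this set lies in \<open>F\<close>, so that
integral is again a covariance with \<open>V\<close>.\<close>
lemma (in prob_space) covariance_le_event_covariance:
  fixes U V :: "'a \<Rightarrow> real"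
  assumes sub: "subalgebra M F"
    and U: "U \<in> borel_measurable F" "AE x in M. \<bar>U x\<bar> \<le> a"
    and V: "V \<in> borel_measurable M" "AE x in M. \<bar>V x\<bar> \<le> b"
  obtains S where "S \<in> sets F"
    "\<bar>expectation (\<lambda>x. U x * V x) - expectation U * expectation V\<bar>
      \<le> 2 * a * \<bar>expectation (\<lambda>x. indicator S x * V x) - prob S * expectation V\<bar>"
proof -
  interpret F: finite_measure_subalgebra M F
    by (standard) (rule sub)
  have space_F: "space F = space M"
    using sub by (simp add: subalgebra_def)
  have UM[measurable]: "U \<in> borel_measurable M"
    by (rule measurable_from_subalg[OF sub U(1)])
  note [measurable] = V(1)
  have intV: "integrable M V" and intU: "integrable M U"
    using integrable_AE_bounded U(2) V UM by blast+
  have "AE x in M. \<bar>U x * V x\<bar> \<le> a * b"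
    using U(2) V(2) by eventually_elim (auto simp: abs_mult intro!: mult_mono)
  then have intUV: "integrable M (\<lambda>x. U x * V x)"
    by (intro integrable_AE_bounded) auto
  define W where "W x = real_cond_exp M F V x - expectation V" for x
  have WF[measurable]: "W \<in> borel_measurable F"
    unfolding W_def by measurable
  have WM[measurable]: "W \<in> borel_measurable M"
    by (rule measurable_from_subalg[OF sub WF])
  have intC: "integrable M (real_cond_exp M F V)"
    and eC: "expectation (real_cond_exp M F V) = expectation V"
    using F.real_cond_exp_int[OF intV] by auto
  have intW: "integrable M W"
    unfolding W_def using intC by auto
  have eW: "expectation W = 0"
    unfolding W_def using intC eC by (simp add: prob_space)
  have test: "expectation (\<lambda>x. H x * W x) = expectation (\<lambda>x. H x * V x) - expectation H * expectation V"
    if H: "H \<in> borel_measurable F" "integrable M H" "integrable M (\<lambda>x. H x * V x)" for H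
  proof -
    note c = F.real_cond_exp_intg[OF H(3) H(1) V(1)]
    have "expectation (\<lambda>x. H x * W x)
        = expectation (\<lambda>x. H x * real_cond_exp M F V x - H x * expectation V)"
      by (simp add: W_def algebra_simps)
    also have "\<dots> = expectation (\<lambda>x. H x * V x) - expectation H * expectation V"
      using c H by simp
    finally show ?thesis .
  qed
  define S where "S = {x \<in> space F. W x > 0}"
  have SF: "S \<in> sets F"
    unfolding S_def by measurable
  have SM[measurable]: "S \<in> sets M"
    using SF sub by (auto simp: subalgebra_def)
  have intSW: "integrable M (\<lambda>x. indicator S x * W x)"
    using integrable_mult_indicator[OF SM intW] by simp
  have intSV: "integrable M (\<lambda>x. indicator S x * V x)"
    using integrable_mult_indicator[OF SM intV] by simp
  have "expectation (\<lambda>x. \<bar>W x\<bar>) = expectation (\<lambda>x. 2 * (indicator S x * W x) - W x)"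
    by (intro Bochner_Integration.integral_cong) (auto simp: S_def space_F indicator_def)
  also have "\<dots> = 2 * expectation (\<lambda>x. indicator S x * W x)"
    using intSW intW eW by simp
  also have "expectation (\<lambda>x. indicator S x * W x)
      = expectation (\<lambda>x. indicator S x * V x) - prob S * expectation V"
    using test[of "indicator S"] SF intSV SM by (simp add: integrable_real_indicator emeasure_eq_measure)
  finally have absW: "expectation (\<lambda>x. \<bar>W x\<bar>)
      = 2 * (expectation (\<lambda>x. indicator S x * V x) - prob S * expectation V)" .
  have bd: "AE x in M. \<bar>U x * W x\<bar> \<le> a * \<bar>W x\<bar>"
    using U(2) by eventually_elim (auto simp: abs_mult intro!: mult_right_mono)
  have "\<bar>expectation (\<lambda>x. U x * V x) - expectation U * expectation V\<bar> = \<bar>expectation (\<lambda>x. U x * W x)\<bar>"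
    using test[OF U(1) intU intUV] by simp
  also have "\<dots> \<le> expectation (\<lambda>x. \<bar>U x * W x\<bar>)"
    by (rule integral_abs_bound)
  also have "\<dots> \<le> expectation (\<lambda>x. a * \<bar>W x\<bar>)"
  proof (rule integral_mono_AE)
    show i: "integrable M (\<lambda>x. a * \<bar>W x\<bar>)"
      using intW by auto
    show "integrable M (\<lambda>x. \<bar>U x * W x\<bar>)"
      by (rule Bochner_Integration.integrable_bound[OF i]) (use bd in auto)
  qed (rule bd)
  also have "\<dots> = 2 * a * (expectation (\<lambda>x. indicator S x * V x) - prob S * expectation V)"
    using absW by simp
  also have "\<dots> \<le> 2 * a * \<bar>expectation (\<lambda>x. indicator S x * V x) - prob S * expectation V\<bar>"
  proof -
    have "AE x in M. 0 \<le> a"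
      using U(2) by eventually_elim auto
    then have "0 \<le> a" by simp
    then show ?thesis by (intro mult_left_mono) auto
  qed
  finally show ?thesis
    using that SF by blast
qed

text \<open>Each application of the preceding lemma replaces one of the two variables by an event of its
sigma-algebra and costs a factor of 2.\<close>
lemma (in prob_space) covariance_strong_mixing_bound:
  fixes U V :: "'a \<Rightarrow> real"
  assumes F: "subalgebra M F" and G: "subalgebra M G"
    and U: "U \<in> borel_measurable F" "AE x in M. \<bar>U x\<bar> \<le> a"
    and V: "V \<in> borel_measurable G" "AE x in M. \<bar>V x\<bar> \<le> b"
    and mix: "\<And>S T. S \<in> sets F \<Longrightarrow> T \<in> sets G \<Longrightarrow> \<bar>prob (S \<inter> T) - prob S * prob T\<bar> \<le> \<alpha>"
  shows "\<bar>expectation (\<lambda>x. U x * V x) - expectation U * expectation V\<bar> \<le> 4 * a * b * \<alpha>"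
proof -
  have ab: "0 \<le> a" "0 \<le> b"
  proof -
    have "AE x in M. 0 \<le> a" using U(2) by eventually_elim auto
    then show "0 \<le> a" by simp
    have "AE x in M. 0 \<le> b" using V(2) by eventually_elim auto
    then show "0 \<le> b" by simp
  qed
  obtain S where S: "S \<in> sets F"
    "\<bar>expectation (\<lambda>x. U x * V x) - expectation U * expectation V\<bar>
      \<le> 2 * a * \<bar>expectation (\<lambda>x. indicator S x * V x) - prob S * expectation V\<bar>"
    using covariance_le_event_covariance[OF F U measurable_from_subalg[OF G V(1)] V(2)] by blast
  have SM: "S \<in> sets M" using S(1) F by (auto simp: subalgebra_def)
  obtain T where T: "T \<in> sets G"
    "\<bar>expectation (\<lambda>x. V x * indicator S x) - expectation V * expectation (indicator S)\<bar>
      \<le> 2 * b * \<bar>expectation (\<lambda>x. indicator T x * indicator S x) - prob T * expectation (indicator S)\<bar>"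
    using covariance_le_event_covariance[OF G V, of "indicator S" 1] SM by (auto simp: indicator_def)
  have TM: "T \<in> sets M" using T(1) G by (auto simp: subalgebra_def)
  have "expectation (\<lambda>x. indicator T x * indicator S x) = prob (S \<inter> T)"
  proof -
    have "(\<lambda>x. indicator T x * indicator S x :: real) = indicator (S \<inter> T)"
      by (auto simp: indicator_def)
    then show ?thesis using SM TM by simp
  qed
  then have "\<bar>expectation (\<lambda>x. V x * indicator S x) - expectation V * prob S\<bar>
      \<le> 2 * b * \<bar>prob (S \<inter> T) - prob S * prob T\<bar>"
    using T(2) SM by (simp add: mult.commute)
  also have "\<dots> \<le> 2 * b * \<alpha>"
    using mix[OF S(1) T(1)] ab by (intro mult_left_mono) auto
  finally have "2 * a * \<bar>expectation (\<lambda>x. indicator S x * V x) - prob S * expectation V\<bar> \<le> 2 * a * (2 * b * \<alpha>)"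
    using ab by (intro mult_left_mono) (auto simp: mult.commute)
  with S(2) show ?thesis by (simp add: algebra_simps)
qed

section \<open>Exponential moments of weakly dependent sums\<close>

text \<open>For negative \<open>x\<close> the bound is \<open>exp x \<le> 1 / (1 - x)\<close> together with
\<open>(1 + x + x\<^sup>2) * (1 - x) = 1 - x ^ 3 \<ge> 1\<close>.\<close>
lemma exp_le_quadratic:
  fixes x :: real
  assumes "\<bar>x\<bar> \<le> 1"
  shows "exp x \<le> 1 + x + x\<^sup>2"
proof (cases "x \<ge> 0")
  case True
  then show ?thesis using exp_bound[of x] assms by simp
next
  case False
  have "1 \<le> (1 + x + x\<^sup>2) * (1 - x)"
  proof -
    have "(1 + x + x\<^sup>2) * (1 - x) = 1 - x * x\<^sup>2"
      by (simp add: algebra_simps power2_eq_square)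
    moreover have "x * x\<^sup>2 \<le> 0" using False by (intro mult_nonpos_nonneg) auto
    ultimately show ?thesis by simp
  qed
  also have "\<dots> \<le> (1 + x + x\<^sup>2) * exp (- x)"
  proof (rule mult_left_mono)
    show "1 - x \<le> exp (- x)" using exp_ge_add_one_self[of "- x"] by simp
    show "0 \<le> 1 + x + x\<^sup>2" using assms by (simp add: abs_le_iff)
  qed
  finally show ?thesis by (simp add: exp_minus field_simps)
qed

lemma (in prob_space) exp_moment_le_variance:
  fixes X :: "'a \<Rightarrow> real"
  assumes X: "X \<in> borel_measurable M" "AE x in M. \<bar>X x\<bar> \<le> 1"
    and "expectation X = 0" "expectation (\<lambda>x. (X x)\<^sup>2) \<le> s"
  shows "expectation (\<lambda>x. exp (X x)) \<le> exp s"
proof -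
  note [measurable] = X(1)
  have iX: "integrable M X" using integrable_AE_bounded[OF X] .
  have iX2: "integrable M (\<lambda>x. (X x)\<^sup>2)"
    using X(2) by (intro integrable_AE_bounded[where B = 1]) (auto simp: abs_square_le_1)
  have iE: "integrable M (\<lambda>x. exp (X x))"
    using X(2) by (intro integrable_AE_bounded[where B = "exp 1"]) auto
  have "expectation (\<lambda>x. exp (X x)) \<le> expectation (\<lambda>x. 1 + X x + (X x)\<^sup>2)"
    using X(2) iE iX iX2 by (intro integral_mono_AE) (auto intro: exp_le_quadratic)
  also have "\<dots> \<le> 1 + s"
    using iX iX2 assms by (simp add: prob_space)
  also have "\<dots> \<le> exp s" by (rule exp_ge_add_one_self)
  finally show ?thesis .
qed

text \<open>This lower bound turns an additive covariance error in the recursion for exponential moments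
into a multiplicative one.\<close>
lemma (in prob_space) exp_moment_ge_1:
  fixes X :: "'a \<Rightarrow> real"
  assumes X: "X \<in> borel_measurable M" "AE x in M. \<bar>X x\<bar> \<le> B" and "expectation X = 0"
  shows "1 \<le> expectation (\<lambda>x. exp (X x))"
proof -
  note [measurable] = X(1)
  have iX: "integrable M X" using integrable_AE_bounded[OF X] .
  have iE: "integrable M (\<lambda>x. exp (X x))"
    using X(2) by (intro integrable_AE_bounded[where B = "exp B"]) auto
  have "1 = expectation (\<lambda>x. 1 + X x)"
    using iX assms by (simp add: prob_space)
  also have "\<dots> \<le> expectation (\<lambda>x. exp (X x))"
    using iX iE by (intro integral_mono) (auto intro: exp_ge_add_one_self)
  finally show ?thesis .
qed

text \<open>Let \<open>m j\<close> be the exponential moment of the sum of the first \<open>j\<close> variables and let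
\<open>g = \<alpha> powr (1 / (R + 1))\<close>.  Splitting off one variable multiplies the moment by at most
\<open>exp s\<close>, up to a covariance.  The covariance bound contains the supremum norm of all previous
factors, which grows like \<open>exp (j / 2)\<close>; the root in \<open>g\<close> is chosen so that
\<open>\<alpha> = g ^ (R + 1)\<close> can absorb this growth and still leave one factor \<open>g\<close>.  The absorption works
when \<open>g * exp (1 / 2) \<le> 1\<close>; otherwise the claimed bound is weaker than the trivial estimate by
the supremum norm.  The first variable costs no covariance, whence \<open>R - 1\<close> mixing terms.\<close>
lemma (in prob_space) exp_moment_weakly_dependent_sum:
  fixes X :: "nat \<Rightarrow> 'a \<Rightarrow> real" and \<alpha> s :: real
  assumes X: "\<And>i. i < R \<Longrightarrow> X i \<in> borel_measurable M"
      "\<And>i. i < R \<Longrightarrow> AE x in M. \<bar>X i x\<bar> \<le> 1 / 2"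
      "\<And>i. i < R \<Longrightarrow> expectation (X i) = 0"
      "\<And>i. i < R \<Longrightarrow> expectation (\<lambda>x. (X i x)\<^sup>2) \<le> s"
    and F: "\<And>j. j < R \<Longrightarrow> subalgebra M (F j)"
      "\<And>j. j < R \<Longrightarrow> (\<lambda>x. \<Sum>i<j. X i x) \<in> borel_measurable (F j)"
    and G: "\<And>j. j < R \<Longrightarrow> subalgebra M (G j)"
      "\<And>j. j < R \<Longrightarrow> X j \<in> borel_measurable (G j)"
    and mix: "\<And>j S T. j < R \<Longrightarrow> S \<in> sets (F j) \<Longrightarrow> T \<in> sets (G j) \<Longrightarrow>
        \<bar>prob (S \<inter> T) - prob S * prob T\<bar> \<le> \<alpha>"
    and "\<alpha> \<ge> 0" and "R \<ge> 1" and "s \<ge> 0"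
  shows "expectation (\<lambda>x. exp (\<Sum>i<R. X i x))
    \<le> exp (real R * s + real (R - 1) * (10 * sqrt (exp 1) * \<alpha> powr (1 / real (R + 1))))"
proof -
  define g where "g = \<alpha> powr (1 / real (R + 1))"
  define c where "c = 10 * sqrt (exp 1) * g"
  define Y where "Y j x = (\<Sum>i<j. X i x)" for j x
  define m where "m j = expectation (\<lambda>x. exp (Y j x))" for j
  have g0: "g \<ge> 0" by (simp add: g_def)
  have sqrt_e: "sqrt (exp 1) = exp (1 / 2 :: real)"
    by (rule real_sqrt_unique) (auto simp flip: exp_double)
  have \<alpha>_eq: "\<alpha> = g ^ (R + 1)"
  proof (cases "\<alpha> = 0")
    case False
    then have "g ^ (R + 1) = g powr real (R + 1)"
      by (intro powr_realpow[symmetric]) (auto simp: g_def)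
    also have "\<dots> = \<alpha>"
      using \<open>\<alpha> \<ge> 0\<close> False unfolding g_def powr_powr by (simp add: field_simps)
    finally show ?thesis by simp
  qed (simp add: g_def)
  have Ym: "Y j \<in> borel_measurable M" if "j \<le> R" for j
    unfolding Y_def using X(1) that by (intro borel_measurable_sum) auto
  have Yb: "AE x in M. \<bar>Y j x\<bar> \<le> real j / 2" if "j \<le> R" for j
  proof -
    have "AE x in M. \<forall>i\<in>{..<j}. \<bar>X i x\<bar> \<le> 1 / 2"
      using X(2) that by (intro AE_finite_allI) auto
    then show ?thesis
    proof eventually_elim
      case (elim x)
      have "\<bar>Y j x\<bar> \<le> (\<Sum>i<j. \<bar>X i x\<bar>)" unfolding Y_def by (rule sum_abs)
      also have "\<dots> \<le> (\<Sum>i<j. 1 / 2)" using elim by (intro sum_mono) auto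
      finally show ?case by simp
    qed
  qed
  have iX: "integrable M (X i)" if "i < R" for i
    using integrable_AE_bounded X that by blast
  have EY: "expectation (Y j) = 0" if "j \<le> R" for j
  proof -
    have "expectation (Y j) = (\<Sum>i<j. expectation (X i))"
      unfolding Y_def using iX that by (intro Bochner_Integration.integral_sum) auto
    then show ?thesis using X(3) that by simp
  qed
  have m_ge: "1 \<le> m j" if "j \<le> R" for j
    unfolding m_def using exp_moment_ge_1[OF Ym Yb EY] that by blast
  have EX: "expectation (\<lambda>x. exp (X j x)) \<le> exp s" if "j < R" for j
  proof (rule exp_moment_le_variance)
    show "AE x in M. \<bar>X j x\<bar> \<le> 1" using X(2)[OF that] by eventually_elim simp
  qed (use X that in auto)
  have iE: "integrable M (\<lambda>x. exp (Y j x))" if "j \<le> R" for j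
  proof (rule integrable_AE_bounded)
    show "(\<lambda>x. exp (Y j x)) \<in> borel_measurable M" using Ym[OF that] by measurable
    show "AE x in M. \<bar>exp (Y j x)\<bar> \<le> exp (real j / 2)"
      using Yb[OF that] by eventually_elim auto
  qed
  have step: "m (Suc j) \<le> m j * exp s * exp c" if "Suc j \<le> R" for j
  proof (cases "g * exp (1 / 2) \<ge> 1")
    case True
    \<comment> \<open>The new factor is at most \<open>exp (1 / 2)\<close>, which is at most \<open>exp c\<close>.\<close>
    have "c \<ge> 1 / 2"
      using True by (simp add: c_def sqrt_e mult.commute)
    have "m (Suc j) \<le> expectation (\<lambda>x. exp (1 / 2) * exp (Y j x))"
      unfolding m_def
    proof (rule integral_mono_AE)
      show "AE x in M. exp (Y (Suc j) x) \<le> exp (1 / 2) * exp (Y j x)"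
      proof -
        have "AE x in M. \<bar>X j x\<bar> \<le> 1 / 2" using X(2) that by auto
        then show ?thesis
          by eventually_elim (auto simp: Y_def simp flip: exp_add)
      qed
    qed (use iE that in auto)
    also have "\<dots> = m j * 1 * exp (1 / 2)" by (simp add: m_def)
    also have "\<dots> \<le> m j * exp s * exp c"
      using m_ge[of j] that \<open>c \<ge> 1 / 2\<close> \<open>s \<ge> 0\<close> by (intro mult_mono) auto
    finally show ?thesis .
  next
    case False
    have j: "j < R" using that by simp
    have cov: "\<bar>expectation (\<lambda>x. exp (Y j x) * exp (X j x)) - m j * expectation (\<lambda>x. exp (X j x))\<bar>
        \<le> 4 * exp (real j / 2) * exp (1 / 2) * \<alpha>"
      unfolding m_def
    proof (rule covariance_strong_mixing_bound[OF F(1)[OF j] G(1)[OF j]])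
      show "(\<lambda>x. exp (Y j x)) \<in> borel_measurable (F j)"
        using F(2)[OF j] unfolding Y_def by measurable
      show "(\<lambda>x. exp (X j x)) \<in> borel_measurable (G j)"
        using G(2)[OF j] by measurable
      show "AE x in M. \<bar>exp (Y j x)\<bar> \<le> exp (real j / 2)"
        using Yb[of j] j by auto
      show "AE x in M. \<bar>exp (X j x)\<bar> \<le> exp (1 / 2)"
        using X(2)[OF j] by eventually_elim auto
    qed (use mix j in auto)
    \<comment> \<open>Each of the \<open>j + 1 \<le> R\<close> factors \<open>exp (1 / 2)\<close> is paired with a factor \<open>g\<close> of \<open>\<alpha>\<close>.\<close>
    have "exp (real j / 2) * exp (1 / 2) = exp (1 / 2 :: real) ^ Suc j"
      by (simp add: field_simps flip: exp_add exp_of_nat_mult)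
    also have "\<dots> \<le> exp (1 / 2) ^ R"
      using that by (intro power_increasing) auto
    finally have "exp (real j / 2) * exp (1 / 2) * \<alpha> \<le> exp (1 / 2) ^ R * \<alpha>"
      using \<open>\<alpha> \<ge> 0\<close> by (intro mult_right_mono)
    also have "\<dots> = g * (g * exp (1 / 2)) ^ R"
      by (simp add: \<alpha>_eq power_mult_distrib)
    also have "\<dots> \<le> g * 1"
      using False g0 by (intro mult_left_mono power_le_one) auto
    finally have "m (Suc j) \<le> m j * expectation (\<lambda>x. exp (X j x)) + 4 * g"
      using cov by (simp add: m_def Y_def exp_add)
    also have "\<dots> \<le> m j * exp s + 4 * g"
      using EX[OF j] m_ge[of j] j by (intro add_right_mono mult_left_mono) auto
    also have "\<dots> \<le> m j * exp s + (m j * exp s) * (4 * g)"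
    proof -
      have "1 * 1 \<le> m j * exp s" using m_ge[of j] j \<open>s \<ge> 0\<close> by (intro mult_mono) auto
      then have "1 * (4 * g) \<le> (m j * exp s) * (4 * g)" using g0 by (intro mult_right_mono) auto
      then show ?thesis by simp
    qed
    also have "\<dots> = m j * exp s * (1 + 4 * g)" by (simp add: algebra_simps)
    also have "\<dots> \<le> m j * exp s * exp c"
    proof (intro mult_left_mono)
      have "1 \<le> exp (1 / 2 :: real)" by simp
      then have "4 \<le> 10 * exp (1 / 2 :: real)" by linarith
      then have "4 * g \<le> c" unfolding c_def sqrt_e using g0 by (intro mult_right_mono) auto
      then show "1 + 4 * g \<le> exp c" using exp_ge_add_one_self[of c] by linarith
      show "0 \<le> m j * exp s" using m_ge[of j] j by auto
    qed
    finally show ?thesis .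
  qed
  have ind: "m (Suc j) \<le> exp (real (Suc j) * s + real j * c)" if "Suc j \<le> R" for j
    using that
  proof (induction j)
    case 0
    then show ?case using EX[of 0] by (simp add: m_def Y_def)
  next
    case (Suc j)
    have "m (Suc (Suc j)) \<le> m (Suc j) * exp s * exp c" using step Suc.prems by simp
    also have "\<dots> \<le> exp (real (Suc j) * s + real j * c) * exp s * exp c"
      using Suc by (intro mult_right_mono) auto
    also have "\<dots> = exp (real (Suc (Suc j)) * s + real (Suc j) * c)"
      by (simp add: algebra_simps flip: exp_add)
    finally show ?case .
  qed
  show ?thesis
    using ind[of "R - 1"] \<open>R \<ge> 1\<close> by (simp add: m_def Y_def c_def g_def)
qed

section \<open>The mixing coefficient of a tree-indexed field\<close>

text \<open>The set system \<open>gen_sigma M Z I\<close> as a measure, so that measurability with respect to it can be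
stated.\<close>
definition sigma_of :: "'a measure \<Rightarrow> ('v \<Rightarrow> 'a \<Rightarrow> real) \<Rightarrow> 'v set \<Rightarrow> 'a measure" where
  "sigma_of M Z I = sigma (space M) (\<Union>v\<in>I. {Z v -` S \<inter> space M | S. S \<in> sets borel})"

lemma sigma_of_space: "space (sigma_of M Z I) = space M"
  unfolding sigma_of_def by (intro space_measure_of) auto

lemma sigma_of_sets: "sets (sigma_of M Z I) = gen_sigma M Z I"
  unfolding sigma_of_def gen_sigma_def by (intro sets_measure_of) auto

lemma sigma_of_subalgebra:
  assumes "\<And>v. v \<in> I \<Longrightarrow> Z v \<in> borel_measurable M"
  shows "subalgebra M (sigma_of M Z I)"
  unfolding subalgebra_def sigma_of_space sigma_of_sets gen_sigma_def
  using assms by (intro conjI sets.sigma_sets_subset) (auto simp: measurable_sets)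

lemma sigma_of_measurable:
  assumes "v \<in> I"
  shows "Z v \<in> borel_measurable (sigma_of M Z I)"
proof (rule measurableI)
  fix S :: "real set" assume "S \<in> sets borel"
  then show "Z v -` S \<inter> space (sigma_of M Z I) \<in> sets (sigma_of M Z I)"
    unfolding sigma_of_sets sigma_of_space gen_sigma_def using assms
    by (intro sigma_sets.Basic) auto
qed auto

lemma (in prob_space) event_covariance_le_1: "\<bar>prob S - prob T * prob U\<bar> \<le> 1"
proof -
  have "0 \<le> prob T * prob U" by simp
  moreover have "prob T * prob U \<le> 1" by (intro mult_le_one) auto
  ultimately show ?thesis
    using prob_le_1[of S] measure_nonneg[of M S] by linarith
qed

lemma (in prob_space)
  shows mixing_coeff_bound: "\<lbrakk>I \<subseteq> nodes A; J \<subseteq> nodes A; enat n \<le> tree_setdist A I J;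
      S \<in> gen_sigma M Z I; T \<in> gen_sigma M Z J\<rbrakk>
      \<Longrightarrow> \<bar>prob (S \<inter> T) - prob S * prob T\<bar> \<le> mixing_coeff A M Z n"
    and mixing_coeff_nonneg: "0 \<le> mixing_coeff A M Z n"
    and mixing_coeff_le_1: "mixing_coeff A M Z n \<le> 1"
proof -
  define c where "c = (\<lambda>(S, T). \<bar>prob (S \<inter> T) - prob S * prob T\<bar>)"
  define h where "h = (\<lambda>(I, J). SUP p\<in>gen_sigma M Z I \<times> gen_sigma M Z J. c p)"
  define D where "D = {(I, J). I \<subseteq> nodes A \<and> J \<subseteq> nodes A \<and> enat n \<le> tree_setdist A I J}"
  have coeff: "mixing_coeff A M Z n = (SUP p\<in>D. h p)"
    by (simp add: mixing_coeff_def c_def h_def D_def)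
  have c1: "c p \<le> 1" for p
    unfolding c_def by (auto simp: event_covariance_le_1 split: prod.split)
  have empty: "({}, {}) \<in> gen_sigma M Z I \<times> gen_sigma M Z J" for I J
    by (auto simp: gen_sigma_def intro: sigma_sets.Empty)
  then have h1: "h p \<le> 1" for p
    unfolding h_def by (cases p) (auto intro!: cSUP_least c1)
  have c_le: "c (S, T) \<le> (SUP p\<in>D. h p)"
    if "(I, J) \<in> D" "S \<in> gen_sigma M Z I" "T \<in> gen_sigma M Z J" for I J S T
  proof -
    have "c (S, T) \<le> h (I, J)"
      unfolding h_def prod.case using that(2,3) c1
      by (intro cSUP_upper bdd_aboveI2) auto
    also have "\<dots> \<le> (SUP p\<in>D. h p)"
      using that(1) h1 by (intro cSUP_upper bdd_aboveI2) auto
    finally show ?thesis .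
  qed
  show "\<bar>prob (S \<inter> T) - prob S * prob T\<bar> \<le> mixing_coeff A M Z n"
    if "I \<subseteq> nodes A" "J \<subseteq> nodes A" "enat n \<le> tree_setdist A I J"
      "S \<in> gen_sigma M Z I" "T \<in> gen_sigma M Z J"
    using c_le[of I J S T] that by (simp add: coeff D_def c_def)
  have D: "({}, {}) \<in> D"
    by (simp add: D_def tree_setdist_def top_enat_def)
  show "0 \<le> mixing_coeff A M Z n"
    using c_le[OF D, of "{}" "{}"] empty by (simp add: coeff c_def)
  show "mixing_coeff A M Z n \<le> 1"
    unfolding coeff using D h1 by (intro cSUP_least) auto
qed

lemma (in prob_space) covariance_mixing_coeff_bound:
  fixes U V :: "'a \<Rightarrow> real"
  assumes Z: "\<And>v. v \<in> nodes A \<Longrightarrow> Z v \<in> borel_measurable M"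
    and IJ: "I \<subseteq> nodes A" "J \<subseteq> nodes A" "enat n \<le> tree_setdist A I J"
    and U: "U \<in> borel_measurable (sigma_of M Z I)" "AE x in M. \<bar>U x\<bar> \<le> a"
    and V: "V \<in> borel_measurable (sigma_of M Z J)" "AE x in M. \<bar>V x\<bar> \<le> b"
  shows "\<bar>expectation (\<lambda>x. U x * V x) - expectation U * expectation V\<bar> \<le> 4 * a * b * mixing_coeff A M Z n"
  using IJ Z
  by (intro covariance_strong_mixing_bound[OF sigma_of_subalgebra sigma_of_subalgebra U V]
      mixing_coeff_bound[OF IJ]) (auto simp: sigma_of_sets)

section \<open>Distances in the tree\<close>

text \<open>Numbering the nodes of a generation from 0, the parent of a node is its quotient by \<open>A\<close>.
This translates the index intervals of edges and subtrees into quotients.\<close>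
lemma interval_iff_div:
  fixes c k k' :: nat
  assumes "c > 0" "k \<ge> 1"
  shows "c * (k - 1) + 1 \<le> k' \<and> k' \<le> c * k \<longleftrightarrow> 1 \<le> k' \<and> (k' - 1) div c = k - 1"
proof -
  obtain m where m: "k = Suc m" using assms(2) by (cases k) auto
  show ?thesis
  proof (cases k')
    case (Suc n)
    have "c * m \<le> n \<and> n < c * Suc m \<longleftrightarrow> n div c = m"
    proof
      assume "n div c = m"
      then show "c * m \<le> n \<and> n < c * Suc m"
        using times_div_less_eq_dividend[of c n] dividend_less_times_div[OF assms(1), of n] by simp
    qed (simp add: div_nat_eqI)
    then show ?thesis by (auto simp: m Suc)
  qed simp
qed

lemma edges_iff:
  assumes "A \<ge> 1"
  shows "((j, k), (j', k')) \<in> edges A \<longleftrightarrow>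
    (j, k) \<in> nodes A \<and> j' = Suc j \<and> 1 \<le> k' \<and> (k' - 1) div A = k - 1"
  using interval_iff_div[of A k k'] assms by (auto simp: edges_def nodes_def)

lemma subtree_iff:
  assumes "A \<ge> 1" "(j, k) \<in> nodes A" "P \<ge> 1"
  shows "(j', k') \<in> subtree A j k P \<longleftrightarrow>
    j \<le> j' \<and> j' < j + P \<and> 1 \<le> k' \<and> (k' - 1) div A ^ (j' - j) = k - 1"
proof -
  have k: "1 \<le> k" "k \<le> A ^ j" using assms(2) by (auto simp: nodes_def)
  have "k' \<le> A ^ j'" if "j \<le> j'" "k' \<le> A ^ (j' - j) * k"
  proof -
    have "A ^ (j' - j) * k \<le> A ^ (j' - j) * A ^ j" using k(2) by (intro mult_left_mono) auto
    also have "\<dots> = A ^ j'" using that(1) by (simp flip: power_add)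
    finally show ?thesis using that(2) by simp
  qed
  then show ?thesis
    using interval_iff_div[of "A ^ (j' - j)" k k'] assms(1,3) k
    unfolding subtree_def nodes_def by fastforce
qed

lemma subtree_subset_nodes: "subtree A j k P \<subseteq> nodes A"
  by (auto simp: subtree_def)

abbreviation adjacent :: "nat \<Rightarrow> nat \<times> nat \<Rightarrow> nat \<times> nat \<Rightarrow> bool" where
  "adjacent A x y \<equiv> (x, y) \<in> edges A \<or> (y, x) \<in> edges A"

text \<open>A walk that repeats a vertex can be shortened by cutting out the loop.\<close>
lemma tree_dist_le_walk:
  assumes "p \<noteq> []" "hd p = v" "last p = w" "set p \<subseteq> nodes A" "successively (adjacent A) p"
  shows "tree_dist A v w \<le> enat (length p - 1)"
  using assms
proof (induction "length p" arbitrary: p rule: less_induct)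
  case less
  show ?case
  proof (cases "distinct p")
    case True
    then have "p \<in> paths A v w" using less.prems by (auto simp: paths_def)
    then show ?thesis unfolding tree_dist_def by (rule INF_lower)
  next
    case False
    then obtain xs ys zs y where p: "p = xs @ [y] @ ys @ [y] @ zs"
      using not_distinct_decomp by blast
    define q where "q = xs @ [y] @ zs"
    have "tree_dist A v w \<le> enat (length q - 1)"
    proof (rule less.hyps)
      show "length q < length p" by (simp add: p q_def)
      show "hd q = v" using less.prems(2) by (cases xs) (auto simp: p q_def)
      show "last q = w" using less.prems(3) by (auto simp: p q_def)
      show "successively (adjacent A) q"
        using less.prems(5) by (auto simp: p q_def successively_append_iff successively_Cons)
    qed (use less.prems in \<open>auto simp: p q_def\<close>)
    also have "\<dots> \<le> enat (length p - 1)" by (simp add: p q_def)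
    finally show ?thesis .
  qed
qed

text \<open>A map that sends every edge to an edge or to a single vertex sends a path to a walk with
stutters, and removing the stutters does not make it longer.\<close>
lemma tree_dist_le_contraction:
  assumes nodes: "\<And>x. x \<in> nodes A \<Longrightarrow> \<psi> x \<in> nodes A"
    and edges: "\<And>x y. (x, y) \<in> edges A \<Longrightarrow> y \<in> nodes A \<Longrightarrow> \<psi> x = \<psi> y \<or> adjacent A (\<psi> x) (\<psi> y)"
  shows "tree_dist A (\<psi> v) (\<psi> w) \<le> tree_dist A v w"
  unfolding tree_dist_def[of A v w]
proof (rule INF_greatest)
  fix p assume "p \<in> paths A v w"
  then have p: "p \<noteq> []" "hd p = v" "last p = w" "set p \<subseteq> nodes A" "successively (adjacent A) p"
    by (auto simp: paths_def)
  define q where "q = remdups_adj (map \<psi> p)"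
  have "successively (\<lambda>x y. \<psi> x = \<psi> y \<or> adjacent A (\<psi> x) (\<psi> y)) p"
    using p(5)
  proof (rule successively_mono)
    fix x y assume "x \<in> set p" "y \<in> set p" "adjacent A x y"
    then show "\<psi> x = \<psi> y \<or> adjacent A (\<psi> x) (\<psi> y)"
      using p(4) edges[of x y] edges[of y x] by auto
  qed
  then have s: "successively (\<lambda>x y. x = y \<or> adjacent A x y) q"
    unfolding q_def by (intro successively_remdups_adjI) (simp add: successively_map)
  have "distinct_adj q" by (simp add: q_def)
  then have "successively (adjacent A) q"
    using s unfolding distinct_adj_def successively_conv_nth by metis
  then have "tree_dist A (\<psi> v) (\<psi> w) \<le> enat (length q - 1)"
    using p nodes by (intro tree_dist_le_walk) (auto simp: q_def hd_map last_map)
  also have "\<dots> \<le> enat (length p - 1)"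
    using remdups_adj_length[of "map \<psi> p"] by (simp add: q_def diff_le_mono)
  finally show "tree_dist A (\<psi> v) (\<psi> w) \<le> enat (length p - 1)" .
qed

lemma tree_dist_ge_Lipschitz:
  fixes \<Phi> :: "nat \<times> nat \<Rightarrow> int"
  assumes lip: "\<And>x y. (x, y) \<in> edges A \<Longrightarrow> \<bar>\<Phi> x - \<Phi> y\<bar> \<le> 1"
    and n: "int n \<le> \<Phi> v - \<Phi> w"
  shows "enat n \<le> tree_dist A v w"
  unfolding tree_dist_def
proof (rule INF_greatest)
  fix p assume p: "p \<in> paths A v w"
  have "successively (adjacent A) p \<Longrightarrow> p \<noteq> [] \<Longrightarrow> \<Phi> (hd p) - \<Phi> (last p) \<le> int (length p - 1)" for p
  proof (induction p rule: induct_list012)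
    case (3 x y zs)
    have "\<bar>\<Phi> x - \<Phi> y\<bar> \<le> 1" using 3(3) lip[of x y] lip[of y x] by (auto simp: abs_minus_commute)
    then show ?case using 3 by auto
  qed auto
  then show "enat n \<le> enat (length p - 1)"
    using p n by (force simp: paths_def)
qed

lemma walk_to_root:
  assumes "A \<ge> 1" "(j, k) \<in> nodes A"
  shows "\<exists>p. hd (p @ [(0, 1)]) = (j, k) \<and> length p = j \<and> set p \<subseteq> nodes A
    \<and> successively (adjacent A) (p @ [(0, 1)])"
  using assms(2)
proof (induction j arbitrary: k)
  case 0
  then show ?case by (auto simp: nodes_def intro!: exI[of _ "[]"])
next
  case (Suc j)
  define k1 where "k1 = (k - 1) div A + 1"
  have k: "1 \<le> k" "k \<le> A * A ^ j" using Suc.prems by (auto simp: nodes_def)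
  have "(k - 1) div A < A ^ j" using k assms(1) by (simp add: less_mult_imp_div_less mult.commute)
  then have n1: "(j, k1) \<in> nodes A" by (simp add: k1_def nodes_def)
  from Suc.IH[OF this] obtain p where p: "hd (p @ [(0, 1)]) = (j, k1)" "length p = j"
    "set p \<subseteq> nodes A" "successively (adjacent A) (p @ [(0, 1)])" by blast
  have "((j, k1), (Suc j, k)) \<in> edges A"
    unfolding edges_iff[OF assms(1)] using n1 k by (simp add: k1_def)
  then show ?case using p Suc.prems
    by (intro exI[of _ "(Suc j, k) # p"]) (auto simp: successively_Cons)
qed

lemma tree_dist_via_root:
  assumes "A \<ge> 1" "(j, k) \<in> nodes A" "(j', k') \<in> nodes A"
  shows "tree_dist A (j, k) (j', k') \<le> enat (j + j')"
proof -
  obtain p where p: "hd (p @ [(0, 1)]) = (j, k)" "length p = j" "set p \<subseteq> nodes A"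
    "successively (adjacent A) (p @ [(0, 1)])" using walk_to_root[OF assms(1,2)] by blast
  obtain q where q: "hd (q @ [(0, 1)]) = (j', k')" "length q = j'" "set q \<subseteq> nodes A"
    "successively (adjacent A) (q @ [(0, 1)])" using walk_to_root[OF assms(1,3)] by blast
  have r: "(0, 1) \<in> nodes A" by (simp add: nodes_def)
  have "successively (adjacent A) (rev (q @ [(0, 1)]))"
    unfolding successively_rev by (rule successively_mono[OF q(4)]) auto
  then have "successively (adjacent A) (p @ [(0, 1)] @ rev q)"
    using p(4) by (auto simp: successively_append_iff successively_Cons)
  moreover have "hd (p @ [(0, 1)] @ rev q) = (j, k)" using p(1) by (cases p) auto
  moreover have "last (p @ [(0, 1)] @ rev q) = (j', k')" using q(1) by (cases q) auto
  ultimately have "tree_dist A (j, k) (j', k') \<le> enat (length (p @ [(0, 1)] @ rev q) - 1)"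
    using p(3) q(3) r by (intro tree_dist_le_walk) auto
  then show ?thesis using p(2) q(2) by simp
qed

lemma tree_dist_pos:
  assumes "v \<noteq> w"
  shows "1 \<le> tree_dist A v w"
  unfolding tree_dist_def
proof (rule INF_greatest)
  fix p assume "p \<in> paths A v w"
  then have p: "p \<noteq> []" "hd p = v" "last p = w" by (auto simp: paths_def)
  then obtain x y zs where "p = x # y # zs"
    using assms by (metis last_ConsL list.exhaust list.sel(1))
  then show "1 \<le> enat (length p - 1)" by (simp add: one_enat_def)
qed

text \<open>The isomorphism of the whole tree onto the tree of descendants of \<open>(L, k)\<close>.\<close>
definition embed :: "nat \<Rightarrow> nat \<Rightarrow> nat \<Rightarrow> nat \<times> nat \<Rightarrow> nat \<times> nat" where
  "embed A L k = (\<lambda>(j, i). (L + j, A ^ j * (k - 1) + i))"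

text \<open>The left inverse of \<open>embed\<close> that collapses everything outside the descendants of \<open>(L, k)\<close> to
the root; it contracts edges.\<close>
definition retract :: "nat \<Rightarrow> nat \<Rightarrow> nat \<Rightarrow> nat \<times> nat \<Rightarrow> nat \<times> nat" where
  "retract A L k = (\<lambda>(j, i). if L \<le> j \<and> (i - 1) div A ^ (j - L) = k - 1
     then (j - L, (i - 1) mod A ^ (j - L) + 1) else (0, 1))"

lemma retract_embed:
  assumes "x \<in> nodes A"
  shows "retract A L k (embed A L k x) = x"
proof -
  obtain j i where x: "x = (j, i)" by fastforce
  obtain n where n: "i = Suc n" "n < A ^ j"
    using assms by (cases i) (auto simp: x nodes_def)
  then have "(A ^ j * (k - 1) + n) div A ^ j = k - 1"
    by (intro div_nat_eqI) auto
  then show ?thesis using n unfolding x embed_def retract_def by simp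
qed

lemma bij_betw_embed_subtree:
  assumes "A \<ge> 1" "(L, k) \<in> nodes A" "P \<ge> 1"
  shows "bij_betw (embed A L k) (subtree A 0 1 P) (subtree A L k P)"
proof (rule bij_betw_byWitness[where f' = "retract A L k"])
  have r: "(0, 1) \<in> nodes A" by (simp add: nodes_def)
  note s0 = subtree_iff[OF assms(1) r assms(3)] and s = subtree_iff[OF assms]
  show "\<forall>x\<in>subtree A 0 1 P. retract A L k (embed A L k x) = x"
    using retract_embed subtree_subset_nodes by blast
  show "\<forall>y\<in>subtree A L k P. embed A L k (retract A L k y) = y"
  proof safe
    fix j i assume "(j, i) \<in> subtree A L k P"
    then have ji: "L \<le> j" "1 \<le> i" "(i - 1) div A ^ (j - L) = k - 1" by (auto simp: s)
    have "A ^ (j - L) * (k - 1) + ((i - 1) mod A ^ (j - L) + 1) = i"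
      using ji(2) mult_div_mod_eq[of "A ^ (j - L)" "i - 1"] unfolding ji(3) by simp
    then show "embed A L k (retract A L k (j, i)) = (j, i)"
      using ji by (simp add: embed_def retract_def)
  qed
  show "embed A L k ` subtree A 0 1 P \<subseteq> subtree A L k P"
  proof safe
    fix j i j' i' assume x: "(j', i') \<in> subtree A 0 1 P" and e: "(j, i) = embed A L k (j', i')"
    have "j' < P" using x by (simp add: s0 del: One_nat_def)
    moreover obtain n where "i' = Suc n" "n < A ^ j'"
      using x subtree_subset_nodes[of A 0 1 P] by (cases i') (auto simp: nodes_def)
    moreover have "(A ^ j' * (k - 1) + (i' - 1)) div A ^ j' = k - 1" if "i' - 1 < A ^ j'"
      using that by (intro div_nat_eqI) auto
    ultimately show "(j, i) \<in> subtree A L k P" using e unfolding s by (simp add: embed_def)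
  qed
  show "retract A L k ` subtree A L k P \<subseteq> subtree A 0 1 P"
  proof safe
    fix j i j' i' assume "(j', i') \<in> subtree A L k P" and e: "(j, i) = retract A L k (j', i')"
    then show "(j, i) \<in> subtree A 0 1 P" using assms(1)
      unfolding s s0 retract_def by auto
  qed
qed

lemma div_power_parent:
  fixes A n k1 k2 :: nat
  assumes "(k2 - 1) div A = k1 - 1"
  shows "(k2 - 1) div A ^ Suc n = (k1 - 1) div A ^ n"
  using assms by (simp add: div_mult2_eq)

text \<open>A path between two descendants of \<open>(L, k)\<close> that leaves the tree of descendants is not
shorter: \<open>retract\<close> folds it back.\<close>
lemma tree_dist_embed_ge:
  assumes "A \<ge> 1" "v \<in> nodes A" "w \<in> nodes A"
  shows "tree_dist A v w \<le> tree_dist A (embed A L k v) (embed A L k w)"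
proof -
  have "tree_dist A (retract A L k (embed A L k v)) (retract A L k (embed A L k w))
      \<le> tree_dist A (embed A L k v) (embed A L k w)"
  proof (rule tree_dist_le_contraction)
    fix x assume "x \<in> nodes A"
    then show "retract A L k x \<in> nodes A"
      using assms(1) by (cases x) (auto simp: retract_def nodes_def Suc_le_eq)
  next
    fix x y assume e: "(x, y) \<in> edges A" and "y \<in> nodes A"
    obtain j k1 j' k2 where xy: "x = (j, k1)" "y = (j', k2)" by fastforce
    have j': "j' = Suc j" and k1: "(j, k1) \<in> nodes A" and k2: "1 \<le> k2" "(k2 - 1) div A = k1 - 1"
      using e by (auto simp: xy edges_iff[OF assms(1)])
    consider "Suc j < L" | "Suc j = L" | "L \<le> j" "(k1 - 1) div A ^ (j - L) \<noteq> k - 1"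
      | "L \<le> j" "(k1 - 1) div A ^ (j - L) = k - 1" by linarith
    then show "retract A L k x = retract A L k y \<or> adjacent A (retract A L k x) (retract A L k y)"
    proof cases
      case 4
      have d: "(k2 - 1) div A ^ Suc (j - L) = k - 1"
        using div_power_parent[OF k2(2)] 4(2) by metis
      have "(k2 - 1) mod A ^ Suc (j - L) = A * ((k1 - 1) mod A ^ (j - L)) + (k2 - 1) mod A"
        unfolding power_Suc mod_mult2_eq k2(2) ..
      then have "(k2 - 1) mod A ^ Suc (j - L) div A = (k1 - 1) mod A ^ (j - L)"
        using assms(1) by simp
      then have "((j - L, (k1 - 1) mod A ^ (j - L) + 1),
          (Suc (j - L), (k2 - 1) mod A ^ Suc (j - L) + 1)) \<in> edges A"
        using assms(1) unfolding edges_iff[OF assms(1)] by (auto simp: nodes_def Suc_le_eq)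
      moreover have "Suc j - L = Suc (j - L)" using 4 by simp
      ultimately show ?thesis using 4 d unfolding xy j' retract_def by simp
    next
      case 3
      have "(k2 - 1) div A ^ Suc (j - L) \<noteq> k - 1"
        using div_power_parent[OF k2(2)] 3(2) by metis
      moreover have "Suc j - L = Suc (j - L)" using 3 by simp
      ultimately show ?thesis using 3 unfolding xy j' retract_def by simp
    qed (auto simp: xy j' retract_def)
  qed
  then show ?thesis using assms by (simp add: retract_embed)
qed

section \<open>Pairs of nodes of a subtree by distance\<close>

lemma subtree_root_eq:
  assumes "P \<ge> 1"
  shows "subtree A 0 1 P = (SIGMA j:{..<P}. {1..A ^ j})"
  using assms by (auto simp: subtree_def nodes_def)

lemma finite_subtree_root: "P \<ge> 1 \<Longrightarrow> finite (subtree A 0 1 P)"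
  by (simp add: subtree_root_eq del: One_nat_def)

lemma card_subtree_root:
  assumes "A \<ge> 2" "P \<ge> 1"
  shows "real (card (subtree A 0 1 P)) = (real A ^ P - 1) / (real A - 1)"
  using assms by (simp add: subtree_root_eq geometric_sum flip: lessThan_atLeast0 del: One_nat_def)

lemma tree_dist_root_subtree_finite:
  assumes "A \<ge> 1" "P \<ge> 1" and v: "v \<in> subtree A 0 1 P" and w: "w \<in> subtree A 0 1 P"
  obtains d where "tree_dist A v w = enat d" "d \<le> 2 * (P - 1)"
proof -
  obtain j k j' k' where vw: "v = (j, k)" "w = (j', k')" by fastforce
  have "v \<in> nodes A" "w \<in> nodes A" using v w subtree_subset_nodes by blast+
  then have "tree_dist A v w \<le> enat (j + j')"
    using tree_dist_via_root[OF assms(1)] by (simp add: vw)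
  moreover have "j + j' \<le> 2 * (P - 1)"
    using v w assms(2) by (auto simp: vw subtree_root_eq simp del: One_nat_def)
  ultimately show ?thesis
    using that by (cases "tree_dist A v w") auto
qed

lemma sum_over_distinct_pairs_by_distance:
  fixes a :: "nat \<Rightarrow> real"
  assumes "A \<ge> 1" "P \<ge> 1"
  shows "(\<Sum>(v, w)\<in>{(v, w)\<in>subtree A 0 1 P \<times> subtree A 0 1 P. v \<noteq> w}. a (the_enat (tree_dist A v w)))
      = (\<Sum>d=1..2 * (P - 1). a d * real (pair_count A P d))" (is "?l = ?r")
proof -
  define B where "B = subtree A 0 1 P"
  define D where "D = {(v, w)\<in>B \<times> B. v \<noteq> w}"
  define t where "t = (\<lambda>(v, w). the_enat (tree_dist A v w))"
  have range: "\<exists>d. tree_dist A v w = enat d \<and> d \<le> 2 * (P - 1)" if "v \<in> B" "w \<in> B" for v w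
    using tree_dist_root_subtree_finite[OF assms] that unfolding B_def by metis
  have fin: "finite D"
    by (rule finite_subset[of _ "B \<times> B"]) (use finite_subtree_root assms(2) in \<open>auto simp: D_def B_def\<close>)
  have im: "t ` D \<subseteq> {1..2 * (P - 1)}"
  proof safe
    fix v w assume vw: "(v, w) \<in> D"
    then obtain d where "tree_dist A v w = enat d" "d \<le> 2 * (P - 1)"
      using range[of v w] vw by (auto simp: D_def)
    then show "t (v, w) \<in> {1..2 * (P - 1)}"
      using tree_dist_pos[of v w A] vw by (auto simp: t_def D_def one_enat_def)
  qed
  have self: "tree_dist A v v = 0" if "v \<in> B" for v
  proof -
    have "v \<in> nodes A" using that subtree_subset_nodes unfolding B_def by blast
    then show ?thesis
      using tree_dist_le_walk[of "[v]" v v A] by (simp add: zero_enat_def[symmetric])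
  qed
  have count: "card {x \<in> D. t x = d} = pair_count A P d" if "d \<in> {1..2 * (P - 1)}" for d
  proof -
    have "{x \<in> D. t x = d} = {(v, w) \<in> B \<times> B. tree_dist A v w = enat d}"
      using that range self by (fastforce simp: D_def t_def zero_enat_def)
    then show ?thesis by (simp add: pair_count_def B_def)
  qed
  have "?l = (\<Sum>x\<in>D. a (t x))" by (simp add: D_def B_def t_def case_prod_unfold)
  also have "\<dots> = (\<Sum>d=1..2 * (P - 1). \<Sum>x\<in>{x \<in> D. t x = d}. a (t x))"
    using fin im by (intro sum.group[symmetric]) auto
  also have "\<dots> = (\<Sum>d=1..2 * (P - 1). a d * real (card {x \<in> D. t x = d}))"
    by (intro sum.cong) (auto simp: mult.commute)
  also have "\<dots> = ?r" using count by (intro sum.cong) auto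
  finally show ?thesis .
qed

section \<open>Separation of distant subtrees\<close>

text \<open>Suppose that the ceiling of \<open>ln Q / ln A\<close> is positive, say \<open>c + 1\<close>.  Then \<open>A ^ c < Q\<close>, so the
ancestors of \<open>(L, k)\<close> and \<open>(L, k')\<close> that lie \<open>c\<close> generations above differ.  Let \<open>\<Phi>\<close> be the depth
below the parent generation of these ancestors, counted positively among the descendants of the
first one, negatively among those of the second one, and zero elsewhere.  It changes by at most 1
along an edge, and it is at least \<open>c + 1\<close> at \<open>v\<close> and at most \<open>- (c + 1)\<close> at \<open>w\<close>.\<close>
lemma subtrees_far_apart:
  assumes A: "A \<ge> 2" and P: "P \<ge> 1" and Q: "Q \<ge> 1"
    and k: "(L, k) \<in> nodes A" "(L, k') \<in> nodes A" "k + Q < k'"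
    and v: "v \<in> subtree A L k P" and w: "w \<in> subtree A L k' P"
  shows "enat (2 * nat \<lceil>ln (real Q) / ln (real A)\<rceil>) \<le> tree_dist A v w"
proof (cases "nat \<lceil>ln (real Q) / ln (real A)\<rceil>")
  case (Suc c)
  have A1: "A \<ge> 1" using A by simp
  have "real c < ln (real Q) / ln (real A)" using Suc by linarith
  then have "ln (real A ^ c) < ln (real Q)"
    using A by (simp add: field_simps ln_realpow)
  then have "real A ^ c < real Q" using A Q by simp
  then have cQ: "A ^ c < Q" by (simp flip: of_nat_power)
  have "Q < A ^ L" using k by (auto simp: nodes_def)
  with cQ have "A ^ c < A ^ L" by simp
  then have cL: "c < L" using A by (simp add: power_strict_increasing_iff)
  define l where "l = L - c"
  have l: "l \<ge> 1" "l \<le> L" "L - l = c" using cL by (auto simp: l_def)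
  define m m' where "m = (k - 1) div A ^ c" and "m' = (k' - 1) div A ^ c"
  have "m \<noteq> m'"
  proof
    assume "m = m'"
    have "k' - 1 < A ^ c + A ^ c * m'"
      unfolding m'_def using A by (intro dividend_less_times_div) simp
    also have "\<dots> \<le> A ^ c + (k - 1)"
      unfolding \<open>m = m'\<close>[symmetric] m_def by simp
    finally show False using k cQ by linarith
  qed
  define \<Phi> :: "nat \<times> nat \<Rightarrow> int" where
    "\<Phi> = (\<lambda>(j, i). if j < l then 0
       else if (i - 1) div A ^ (j - l) = m then int (j - l) + 1
       else if (i - 1) div A ^ (j - l) = m' then - (int (j - l) + 1) else 0)"
  have "enat (2 * Suc c) \<le> tree_dist A v w"
  proof (rule tree_dist_ge_Lipschitz[of A \<Phi>])
    fix x y assume e: "(x, y) \<in> edges A"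
    obtain j k1 j' k2 where xy: "x = (j, k1)" "y = (j', k2)" by fastforce
    have j': "j' = Suc j" and k2: "(k2 - 1) div A = k1 - 1"
      using e by (auto simp: xy edges_iff[OF A1])
    show "\<bar>\<Phi> x - \<Phi> y\<bar> \<le> 1"
    proof (cases "l \<le> j")
      case True
      then have "Suc j - l = Suc (j - l)" by simp
      then show ?thesis
        using True div_power_parent[OF k2, of "j - l"] by (simp add: xy j' \<Phi>_def)
    next
      case False
      then show ?thesis by (cases "Suc j = l") (auto simp: xy j' \<Phi>_def)
    qed
  next
    have anc: "l \<le> j \<and> (i - 1) div A ^ (j - l) = (k0 - 1) div A ^ c \<and> c \<le> j - l"
      if "(j, i) \<in> subtree A L k0 P" "(L, k0) \<in> nodes A" for j i k0
    proof -
      have s: "L \<le> j" "(i - 1) div A ^ (j - L) = k0 - 1"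
        using that by (auto simp: subtree_iff[OF A1 that(2) P])
      have "(i - 1) div A ^ (j - l) = (i - 1) div (A ^ (j - L) * A ^ c)"
      proof -
        have "j - l = (j - L) + c" using s(1) l by simp
        then show ?thesis by (simp add: power_add)
      qed
      then show ?thesis using s l by (simp add: div_mult2_eq)
    qed
    obtain j i j' i' where vw: "v = (j, i)" "w = (j', i')" by fastforce
    show "int (2 * Suc c) \<le> \<Phi> v - \<Phi> w"
      using anc[of j i k] anc[of j' i' k'] v w k \<open>m \<noteq> m'\<close>
      by (auto simp: vw \<Phi>_def m_def m'_def) linarith
  qed
  then show ?thesis using Suc by simp
qed (simp add: zero_enat_def[symmetric])

section \<open>Sums over one subtree and over a block of subtrees\<close>

locale bounded_tree_field = prob_space M for M :: "'a measure" +
  fixes Z :: "nat \<times> nat \<Rightarrow> 'a \<Rightarrow> real" and A :: nat and C \<sigma> :: real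
  assumes A: "A \<ge> 2"
    and measurable_Z: "v \<in> nodes A \<Longrightarrow> Z v \<in> borel_measurable M"
    and centred: "v \<in> nodes A \<Longrightarrow> expectation (Z v) = 0"
    and bounded: "v \<in> nodes A \<Longrightarrow> AE \<omega> in M. \<bar>Z v \<omega>\<bar> \<le> C"
    and second_moment: "v \<in> nodes A \<Longrightarrow> expectation (\<lambda>\<omega>. (Z v \<omega>)\<^sup>2) \<le> \<sigma>\<^sup>2"
    and C_nonneg: "0 \<le> C"
begin

definition subtree_sum :: "nat \<Rightarrow> nat \<Rightarrow> nat \<Rightarrow> 'a \<Rightarrow> real" where
  "subtree_sum L P k \<omega> = (\<Sum>v\<in>subtree A L k P. Z v \<omega>)"

text \<open>The bound for the second moment of a subtree sum.\<close>
definition variance_bound :: "nat \<Rightarrow> real" where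
  "variance_bound P = (real A ^ P - 1) / (real A - 1) * \<sigma>\<^sup>2
     + 4 * C\<^sup>2 * (\<Sum>k=1..2 * (P - 1). mixing_coeff A M Z k * real (pair_count A P k))"

lemma variance_bound_nonneg: "0 \<le> variance_bound P"
  unfolding variance_bound_def using A
  by (intro add_nonneg_nonneg mult_nonneg_nonneg divide_nonneg_nonneg sum_nonneg
      mixing_coeff_nonneg) auto

lemma A_ge_1: "A \<ge> 1"
  using A by simp

lemma finite_subtree:
  assumes "(L, k) \<in> nodes A" "P \<ge> 1"
  shows "finite (subtree A L k P)"
  using bij_betw_finite[OF bij_betw_embed_subtree[OF A_ge_1 assms]]
    finite_subtree_root[OF assms(2)] by simp

lemma card_subtree:
  assumes "(L, k) \<in> nodes A" "P \<ge> 1"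
  shows "real (card (subtree A L k P)) = (real A ^ P - 1) / (real A - 1)"
  using bij_betw_same_card[OF bij_betw_embed_subtree[OF A_ge_1 assms]]
    card_subtree_root[OF A assms(2)] by simp

lemma measurable_subtree_sum [measurable]: "subtree_sum L P k \<in> borel_measurable M"
  unfolding subtree_sum_def
  by (intro borel_measurable_sum measurable_Z) (use subtree_subset_nodes in blast)

lemma integrable_Z: "v \<in> nodes A \<Longrightarrow> integrable M (Z v)"
  using integrable_AE_bounded measurable_Z bounded by blast

lemma integrable_Z_mult:
  assumes "v \<in> nodes A" "w \<in> nodes A"
  shows "integrable M (\<lambda>\<omega>. Z v \<omega> * Z w \<omega>)"
proof (rule integrable_AE_bounded)
  show "(\<lambda>\<omega>. Z v \<omega> * Z w \<omega>) \<in> borel_measurable M"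
    using assms by (intro borel_measurable_times measurable_Z)
  show "AE \<omega> in M. \<bar>Z v \<omega> * Z w \<omega>\<bar> \<le> C * C"
    using bounded[OF assms(1)] bounded[OF assms(2)]
    by eventually_elim (auto simp: abs_mult intro: mult_mono)
qed

lemma expectation_subtree_sum: "expectation (subtree_sum L P k) = 0"
proof -
  have "expectation (subtree_sum L P k) = (\<Sum>v\<in>subtree A L k P. expectation (Z v))"
    unfolding subtree_sum_def using subtree_subset_nodes
    by (intro Bochner_Integration.integral_sum integrable_Z) blast
  also have "\<dots> = 0"
    using subtree_subset_nodes by (intro sum.neutral) (blast intro: centred)
  finally show ?thesis .
qed

lemma subtree_sum_bounded:
  assumes "(L, k) \<in> nodes A" "P \<ge> 1"
  shows "AE \<omega> in M. \<bar>subtree_sum L P k \<omega>\<bar> \<le> C * ((real A ^ P - 1) / (real A - 1))"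
proof -
  have "AE \<omega> in M. \<forall>v\<in>subtree A L k P. \<bar>Z v \<omega>\<bar> \<le> C"
    using finite_subtree[OF assms] bounded subtree_subset_nodes by (intro AE_finite_allI) blast+
  then show ?thesis
  proof eventually_elim
    case (elim \<omega>)
    have "\<bar>subtree_sum L P k \<omega>\<bar> \<le> (\<Sum>v\<in>subtree A L k P. \<bar>Z v \<omega>\<bar>)"
      unfolding subtree_sum_def by (rule sum_abs)
    also have "\<dots> \<le> real (card (subtree A L k P)) * C"
      using elim by (intro sum_bounded_above) auto
    finally show ?case using card_subtree[OF assms] by (simp add: mult.commute)
  qed
qed

lemma covariance_nodes:
  assumes "v \<in> nodes A" "w \<in> nodes A" "enat n \<le> tree_dist A v w"
  shows "expectation (\<lambda>\<omega>. Z v \<omega> * Z w \<omega>) \<le> 4 * C\<^sup>2 * mixing_coeff A M Z n"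
proof -
  have "\<bar>expectation (\<lambda>\<omega>. Z v \<omega> * Z w \<omega>) - expectation (Z v) * expectation (Z w)\<bar>
      \<le> 4 * C * C * mixing_coeff A M Z n"
    using assms
    by (intro covariance_mixing_coeff_bound[where I = "{v}" and J = "{w}"] measurable_Z bounded
        sigma_of_measurable) (auto simp: tree_setdist_def)
  then show ?thesis using centred[OF assms(1)] by (simp add: power2_eq_square)
qed

text \<open>The diagonal of the squared sum gives the variances.  Off the diagonal the covariance
inequality is applied to single nodes; their distance is measured after moving the subtree to
the root, which is where the pairs are counted.\<close>
lemma subtree_sum_second_moment:
  assumes "(L, k) \<in> nodes A" "P \<ge> 1"
  shows "expectation (\<lambda>\<omega>. (subtree_sum L P k \<omega>)\<^sup>2) \<le> variance_bound P"
proof -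
  define B where "B = subtree A 0 1 P"
  define D where "D = {(v, w)\<in>B \<times> B. v \<noteq> w}"
  define e where "e = embed A L k"
  have bij: "bij_betw e B (subtree A L k P)"
    unfolding e_def B_def by (rule bij_betw_embed_subtree[OF A_ge_1 assms])
  have fin: "finite B" using finite_subtree_root[OF assms(2)] by (simp add: B_def)
  have finD: "finite D" by (rule finite_subset[of _ "B \<times> B"]) (auto simp: D_def fin)
  have B: "v \<in> nodes A" if "v \<in> B" for v
    using that subtree_subset_nodes unfolding B_def by blast
  have eB: "e v \<in> nodes A" if "v \<in> B" for v
    using bij_betwE[OF bij] that subtree_subset_nodes by blast
  have square: "(subtree_sum L P k \<omega>)\<^sup>2
      = (\<Sum>v\<in>B. (Z (e v) \<omega>)\<^sup>2) + (\<Sum>(v, w)\<in>D. Z (e v) \<omega> * Z (e w) \<omega>)" for \<omega>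
  proof -
    have "subtree_sum L P k \<omega> = (\<Sum>v\<in>B. Z (e v) \<omega>)"
      unfolding subtree_sum_def by (rule sum.reindex_bij_betw[OF bij, symmetric])
    then have "(subtree_sum L P k \<omega>)\<^sup>2 = (\<Sum>(v, w)\<in>B \<times> B. Z (e v) \<omega> * Z (e w) \<omega>)"
      by (simp add: power2_eq_square sum_product sum.cartesian_product)
    also have "B \<times> B = (\<lambda>v. (v, v)) ` B \<union> D" by (auto simp: D_def)
    also have "(\<Sum>(v, w)\<in>\<dots>. Z (e v) \<omega> * Z (e w) \<omega>)
        = (\<Sum>(v, w)\<in>(\<lambda>v. (v, v)) ` B. Z (e v) \<omega> * Z (e w) \<omega>) + (\<Sum>(v, w)\<in>D. Z (e v) \<omega> * Z (e w) \<omega>)"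
      using fin finD by (intro sum.union_disjoint) (auto simp: D_def)
    also have "(\<Sum>(v, w)\<in>(\<lambda>v. (v, v)) ` B. Z (e v) \<omega> * Z (e w) \<omega>) = (\<Sum>v\<in>B. (Z (e v) \<omega>)\<^sup>2)"
      by (subst sum.reindex) (auto simp: inj_on_def power2_eq_square)
    finally show ?thesis .
  qed
  have "expectation (\<lambda>\<omega>. (subtree_sum L P k \<omega>)\<^sup>2)
      = (\<Sum>v\<in>B. expectation (\<lambda>\<omega>. (Z (e v) \<omega>)\<^sup>2))
        + (\<Sum>(v, w)\<in>D. expectation (\<lambda>\<omega>. Z (e v) \<omega> * Z (e w) \<omega>))"
  proof -
    have i: "integrable M (\<lambda>\<omega>. Z (e v) \<omega> * Z (e w) \<omega>)" if "v \<in> B" "w \<in> B" for v w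
      using that eB integrable_Z_mult by blast
    then have i2: "integrable M (\<lambda>\<omega>. (Z (e v) \<omega>)\<^sup>2)" if "v \<in> B" for v
      using that by (simp add: power2_eq_square)
    show ?thesis
      unfolding square case_prod_unfold using i i2
      by (subst Bochner_Integration.integral_add)
        (auto simp: D_def intro!: Bochner_Integration.integral_sum Bochner_Integration.integrable_sum)
  qed
  also have "\<dots> \<le> (\<Sum>v\<in>B. \<sigma>\<^sup>2) + (\<Sum>(v, w)\<in>D. 4 * C\<^sup>2 * mixing_coeff A M Z (the_enat (tree_dist A v w)))"
  proof (intro add_mono sum_mono)
    fix x assume x: "x \<in> D"
    obtain v w where vw: "x = (v, w)" by (cases x)
    have B': "v \<in> B" "w \<in> B" "v \<noteq> w" using x by (auto simp: vw D_def)
    have "enat (the_enat (tree_dist A v w)) = tree_dist A v w"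
      using tree_dist_root_subtree_finite[OF A_ge_1 assms(2), of v w] B'
      unfolding B_def by (metis the_enat.simps)
    also have "\<dots> \<le> tree_dist A (e v) (e w)"
      unfolding e_def using tree_dist_embed_ge[OF A_ge_1] B B' by blast
    finally show "(case x of (v, w) \<Rightarrow> expectation (\<lambda>\<omega>. Z (e v) \<omega> * Z (e w) \<omega>))
        \<le> (case x of (v, w) \<Rightarrow> 4 * C\<^sup>2 * mixing_coeff A M Z (the_enat (tree_dist A v w)))"
      using covariance_nodes eB B' by (simp add: vw)
  qed (use eB second_moment in auto)
  also have "\<dots> = variance_bound P"
    using sum_over_distinct_pairs_by_distance[OF A_ge_1 assms(2),
        of "\<lambda>d. 4 * C\<^sup>2 * mixing_coeff A M Z d"] card_subtree_root[OF A assms(2)]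
    by (simp add: variance_bound_def B_def D_def sum_distrib_left mult.assoc)
  finally show ?thesis .
qed

text \<open>The block sums, scaled by \<open>\<delta>\<close>, are the weakly dependent variables: the union of all earlier
blocks is separated from the next one by \<open>Q\<close> subtrees.  The factor \<open>(real n)\<^sup>2\<close> in the variance
comes from the Cauchy-Schwarz inequality inside a block.\<close>
lemma block_exp_moment:
  fixes G :: "nat \<Rightarrow> nat set" and \<delta> :: real and n Q :: nat
  assumes P: "P \<ge> 1" and Q: "Q \<ge> 1" and R: "R \<ge> 1"
    and G: "\<And>i. G i \<subseteq> {1..A ^ L}" "\<And>i. card (G i) \<le> n"
    and gap: "\<And>i j k k'. i < j \<Longrightarrow> k \<in> G i \<Longrightarrow> k' \<in> G j \<Longrightarrow> k + Q < k'"
    and \<delta>: "\<bar>\<delta>\<bar> * (real n * (C * ((real A ^ P - 1) / (real A - 1)))) \<le> 1 / 2"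
    and \<alpha>: "\<alpha> = mixing_coeff A M Z (2 * nat \<lceil>ln (real Q) / ln (real A)\<rceil>)"
  shows "expectation (\<lambda>\<omega>. exp (\<delta> * (\<Sum>i<R. \<Sum>k\<in>G i. subtree_sum L P k \<omega>)))
    \<le> exp (real R * (\<delta>\<^sup>2 * (real n)\<^sup>2 * variance_bound P)
        + real (R - 1) * (10 * sqrt (exp 1) * \<alpha> powr (1 / real (R + 1))))"
proof -
  define K where "K = C * ((real A ^ P - 1) / (real A - 1))"
  define X where "X i \<omega> = \<delta> * (\<Sum>k\<in>G i. subtree_sum L P k \<omega>)" for i \<omega>
  define J where "J i = (\<Union>k\<in>G i. subtree A L k P)" for i
  define I where "I j = (\<Union>i<j. J i)" for j
  have K0: "0 \<le> K" unfolding K_def using A C_nonneg by simp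
  have node: "(L, k) \<in> nodes A" if "k \<in> G i" for k i
    using G(1)[of i] that by (auto simp: nodes_def)
  have fin: "finite (G i)" for i
    using G(1) finite_subset by blast
  have JI: "J i \<subseteq> nodes A" "I i \<subseteq> nodes A" for i
    unfolding I_def J_def using subtree_subset_nodes by blast+
  have X_meas: "X i \<in> borel_measurable M" for i
    unfolding X_def by measurable
  have X_gen: "X i \<in> borel_measurable (sigma_of M Z I)" if "J i \<subseteq> I" for i I
    unfolding X_def subtree_sum_def using that
    by (intro borel_measurable_times borel_measurable_const borel_measurable_sum sigma_of_measurable)
      (auto simp: J_def)
  have block_bound: "AE \<omega> in M. \<bar>X i \<omega>\<bar> \<le> 1 / 2" for i
  proof -
    have "AE \<omega> in M. \<forall>k\<in>G i. \<bar>subtree_sum L P k \<omega>\<bar> \<le> K"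
      unfolding K_def using fin node P by (intro AE_finite_allI subtree_sum_bounded)
    then show ?thesis
    proof eventually_elim
      case (elim \<omega>)
      have "\<bar>\<Sum>k\<in>G i. subtree_sum L P k \<omega>\<bar> \<le> (\<Sum>k\<in>G i. \<bar>subtree_sum L P k \<omega>\<bar>)"
        by (rule sum_abs)
      also have "\<dots> \<le> real (card (G i)) * K"
        using elim by (intro sum_bounded_above) auto
      also have "\<dots> \<le> real n * K"
        using G(2) K0 by (intro mult_right_mono) auto
      finally have "\<bar>X i \<omega>\<bar> \<le> \<bar>\<delta>\<bar> * (real n * K)"
        unfolding X_def abs_mult by (intro mult_left_mono) auto
      then show ?case using \<delta> unfolding K_def by linarith
    qed
  qed
  have iS: "integrable M (subtree_sum L P k)" if "k \<in> G i" for i k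
    using integrable_AE_bounded[OF measurable_subtree_sum subtree_sum_bounded[OF node[OF that] P]] .
  have iS2: "integrable M (\<lambda>\<omega>. (subtree_sum L P k \<omega>)\<^sup>2)" if "k \<in> G i" for i k
  proof (rule integrable_AE_bounded)
    show "AE \<omega> in M. \<bar>(subtree_sum L P k \<omega>)\<^sup>2\<bar> \<le> K\<^sup>2"
      using subtree_sum_bounded[OF node[OF that] P]
      by eventually_elim (auto simp: K_def abs_le_square_iff power2_le_iff_abs_le)
  qed measurable
  have X_mean: "expectation (X i) = 0" for i
  proof -
    have "expectation (X i) = \<delta> * (\<Sum>k\<in>G i. expectation (subtree_sum L P k))"
      unfolding X_def using iS by (simp add: Bochner_Integration.integral_sum)
    then show ?thesis by (simp add: expectation_subtree_sum)
  qed
  have X_var: "expectation (\<lambda>\<omega>. (X i \<omega>)\<^sup>2) \<le> \<delta>\<^sup>2 * (real n)\<^sup>2 * variance_bound P" for i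
  proof -
    have "expectation (\<lambda>\<omega>. (X i \<omega>)\<^sup>2)
        \<le> expectation (\<lambda>\<omega>. \<delta>\<^sup>2 * ((\<Sum>k\<in>G i. (subtree_sum L P k \<omega>)\<^sup>2) * real (card (G i))))"
    proof (rule integral_mono)
      show "integrable M (\<lambda>\<omega>. (X i \<omega>)\<^sup>2)"
      proof (rule integrable_AE_bounded)
        show "AE \<omega> in M. \<bar>(X i \<omega>)\<^sup>2\<bar> \<le> 1"
          using block_bound[of i] by eventually_elim (auto simp: abs_square_le_1)
      qed (use X_meas in measurable)
      show "(X i \<omega>)\<^sup>2 \<le> \<delta>\<^sup>2 * ((\<Sum>k\<in>G i. (subtree_sum L P k \<omega>)\<^sup>2) * real (card (G i)))" for \<omega>
        unfolding X_def power_mult_distrib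
        by (intro mult_left_mono sum_squared_le_sum_of_squares) auto
    qed (use iS2 in auto)
    also have "\<dots> = \<delta>\<^sup>2 * ((\<Sum>k\<in>G i. expectation (\<lambda>\<omega>. (subtree_sum L P k \<omega>)\<^sup>2)) * real (card (G i)))"
      using iS2 by (simp add: Bochner_Integration.integral_sum)
    also have "\<dots> \<le> \<delta>\<^sup>2 * ((real n * variance_bound P) * real n)"
    proof (intro mult_left_mono mult_mono)
      have "(\<Sum>k\<in>G i. expectation (\<lambda>\<omega>. (subtree_sum L P k \<omega>)\<^sup>2)) \<le> real (card (G i)) * variance_bound P"
        using subtree_sum_second_moment[OF node P] by (intro sum_bounded_above)
      also have "\<dots> \<le> real n * variance_bound P"
        using G(2) variance_bound_nonneg by (intro mult_right_mono) auto
      finally show "(\<Sum>k\<in>G i. expectation (\<lambda>\<omega>. (subtree_sum L P k \<omega>)\<^sup>2)) \<le> real n * variance_bound P" .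
    qed (use G(2) variance_bound_nonneg in auto)
    finally show ?thesis by (simp add: power2_eq_square mult_ac)
  qed
  have "enat (2 * nat \<lceil>ln (real Q) / ln (real A)\<rceil>) \<le> tree_setdist A (I j) (J j)" for j
    unfolding tree_setdist_def
  proof (intro INF_greatest, safe)
    fix a b a' b' assume "(a, b) \<in> I j" "(a', b') \<in> J j"
    then obtain i k k' where "i < j" "k \<in> G i" "k' \<in> G j"
      "(a, b) \<in> subtree A L k P" "(a', b') \<in> subtree A L k' P"
      by (auto simp: I_def J_def)
    then show "enat (2 * nat \<lceil>ln (real Q) / ln (real A)\<rceil>) \<le> tree_dist A (a, b) (a', b')"
      using subtrees_far_apart[OF A P Q] node gap by blast
  qed
  then have mix: "\<bar>prob (S \<inter> T) - prob S * prob T\<bar> \<le> \<alpha>"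
    if "S \<in> sets (sigma_of M Z (I j))" "T \<in> sets (sigma_of M Z (J j))" for S T j
    unfolding \<alpha> using that JI by (intro mixing_coeff_bound) (auto simp: sigma_of_sets)
  have "expectation (\<lambda>\<omega>. exp (\<Sum>i<R. X i \<omega>))
    \<le> exp (real R * (\<delta>\<^sup>2 * (real n)\<^sup>2 * variance_bound P)
        + real (R - 1) * (10 * sqrt (exp 1) * \<alpha> powr (1 / real (R + 1))))"
  proof (rule exp_moment_weakly_dependent_sum[where F = "\<lambda>j. sigma_of M Z (I j)"
        and G = "\<lambda>j. sigma_of M Z (J j)"])
    show "subalgebra M (sigma_of M Z (I j))" "subalgebra M (sigma_of M Z (J j))" for j
      using JI by (auto intro!: sigma_of_subalgebra measurable_Z)
    show "(\<lambda>\<omega>. \<Sum>i<j. X i \<omega>) \<in> borel_measurable (sigma_of M Z (I j))" for j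
      by (intro borel_measurable_sum X_gen) (auto simp: I_def)
    show "0 \<le> \<alpha>" unfolding \<alpha> by (rule mixing_coeff_nonneg)
  qed (use X_meas X_gen block_bound X_mean X_var mix R variance_bound_nonneg in auto)
  then show ?thesis by (simp add: X_def sum_distrib_left)
qed

lemma sum_generation_eq:
  assumes "P \<ge> 1"
  shows "(\<Sum>v\<in>(\<Union>k\<in>{1..A ^ L}. subtree A L k P). Z v \<omega>) = (\<Sum>k\<in>{1..A ^ L}. subtree_sum L P k \<omega>)"
  unfolding subtree_sum_def
proof (rule sum.UNION_disjoint)
  have n: "(L, k) \<in> nodes A" if "k \<in> {1..A ^ L}" for k
    using that by (auto simp: nodes_def)
  show "\<forall>k\<in>{1..A ^ L}. finite (subtree A L k P)"
    using n finite_subtree assms by blast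
  show "\<forall>k\<in>{1..A ^ L}. \<forall>k'\<in>{1..A ^ L}. k \<noteq> k' \<longrightarrow> subtree A L k P \<inter> subtree A L k' P = {}"
    using subtree_iff[OF A_ge_1 n assms] by (auto simp del: One_nat_def)
qed simp

section \<open>Alternating blocks and the Bernstein inequality\<close>

text \<open>The index \<open>i\<close> counts periods of length \<open>q\<close>, and \<open>W\<close> is a set of offsets in a period: for
\<open>W = {0..<P2}\<close> and \<open>W = {P2..<q}\<close> these are the two kinds of alternating blocks.\<close>
definition blocks :: "nat \<Rightarrow> nat \<Rightarrow> nat set \<Rightarrow> nat \<Rightarrow> nat set" where
  "blocks N q W i = {k \<in> {1..N}. (k - 1) div q = i \<and> (k - 1) mod q \<in> W}"

lemma card_blocks:
  assumes "finite W"
  shows "card (blocks N q W i) \<le> card W"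
proof (rule card_inj_on_le[of "\<lambda>k. (k - 1) mod q"])
  show "inj_on (\<lambda>k. (k - 1) mod q) (blocks N q W i)"
  proof (rule inj_onI)
    fix k k' assume "k \<in> blocks N q W i" "k' \<in> blocks N q W i" "(k - 1) mod q = (k' - 1) mod q"
    then have "k - 1 = k' - 1" "1 \<le> k" "1 \<le> k'"
      by (auto simp: blocks_def) (metis div_mult_mod_eq)
    then show "k = k'" by linarith
  qed
qed (use assms in \<open>auto simp: blocks_def\<close>)

lemma blocks_gap:
  assumes ij: "i < j" and k: "k \<in> blocks N q {a..<b} i" and k': "k' \<in> blocks N q {a..<b} j"
    and "Q + b \<le> q + a" 
  shows "k + Q < k'"
proof -
  have k_eq: "k = q * i + (k - 1) mod q + 1" "(k - 1) mod q < b"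
    using k mult_div_mod_eq[of q "k - 1"] unfolding blocks_def by auto
  have k'_eq: "k' = q * j + (k' - 1) mod q + 1" "a \<le> (k' - 1) mod q"
    using k' mult_div_mod_eq[of q "k' - 1"] unfolding blocks_def by auto
  have "q * i + q \<le> q * j"
    using mult_le_mono2[of "Suc i" j q] ij by simp
  then show ?thesis
    using k_eq k'_eq \<open>Q + b \<le> q + a\<close> by linarith
qed

lemma sum_blocks:
  fixes y :: "nat \<Rightarrow> real"
  assumes q: "a \<le> q" "q > 0"
  shows "(\<Sum>k\<in>{1..N}. y k)
    = (\<Sum>i<Suc ((N - 1) div q). \<Sum>k\<in>blocks N q {0..<a} i. y k)
      + (\<Sum>i<Suc ((N - 1) div q). \<Sum>k\<in>blocks N q {a..<q} i. y k)"
proof -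
  have group: "(\<Sum>i<Suc ((N - 1) div q). \<Sum>k\<in>blocks N q W i. y k)
      = (\<Sum>k\<in>{k \<in> {1..N}. (k - 1) mod q \<in> W}. y k)" for W
  proof -
    have "(\<Sum>i<Suc ((N - 1) div q). \<Sum>k\<in>{k \<in> {k \<in> {1..N}. (k - 1) mod q \<in> W}. (k - 1) div q = i}. y k)
      = (\<Sum>k\<in>{k \<in> {1..N}. (k - 1) mod q \<in> W}. y k)"
      by (rule sum.group) (auto simp: less_Suc_eq_le intro!: div_le_mono)
    moreover have "blocks N q W i = {k \<in> {k \<in> {1..N}. (k - 1) mod q \<in> W}. (k - 1) div q = i}" for i
      by (auto simp: blocks_def)
    ultimately show ?thesis by simp
  qed
  have "{1..N} = {k \<in> {1..N}. (k - 1) mod q \<in> {0..<a}} \<union> {k \<in> {1..N}. (k - 1) mod q \<in> {a..<q}}"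
    using q(2) by auto
  from arg_cong[OF this, of "sum y"] have "(\<Sum>k\<in>{1..N}. y k) = (\<Sum>k\<in>{k \<in> {1..N}. (k - 1) mod q \<in> {0..<a}} \<union> {k \<in> {1..N}. (k - 1) mod q \<in> {a..<q}}. y k)" .
  also have "\<dots> = (\<Sum>k\<in>{k \<in> {1..N}. (k - 1) mod q \<in> {0..<a}}. y k) + (\<Sum>k\<in>{k \<in> {1..N}. (k - 1) mod q \<in> {a..<q}}. y k)"
    by (rule sum.union_disjoint) auto
  finally show ?thesis unfolding group .
qed

text \<open>With \<open>x = A ^ L / (P2 + Q2)\<close> there are \<open>R \<le> x + 1\<close> periods, hence at most \<open>x\<close> mixing terms.
The exponent of the mixing coefficient is \<open>1 / (x + 2) \<le> 1 / (R + 1)\<close>, and the coefficient is at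
most 1.  The bound on \<open>\<beta>\<close> keeps the scaled block sums within \<open>1 / 2\<close>.\<close>
lemma half_sum_exp_moment:
  fixes \<beta> \<delta> :: real and P P2 Q2 f L a b :: nat
  assumes P: "P \<ge> 1" and Q2: "Q2 \<ge> 1" "Q2 \<le> P2"
    and W: "b - a \<le> P2" "Q2 + b \<le> (P2 + Q2) + a"
    and N: "P2 + Q2 < A ^ L" 
    and \<beta>: "0 < \<beta>" "\<beta> \<le> (real A - 1) / (4 * exp 1 * C * real P2 * (real A ^ P - 1))" and "C > 0"
    and \<delta>: "\<bar>\<delta>\<bar> = 2 * \<beta>"
    and f: "f = 2 * nat \<lceil>ln (real Q2) / ln (real A)\<rceil>"
    and R: "R = Suc ((A ^ L - 1) div (P2 + Q2))"
  shows "expectation (\<lambda>\<omega>. exp (\<delta> * (\<Sum>i<R. \<Sum>k\<in>blocks (A ^ L) (P2 + Q2) {a..<b} i. subtree_sum L P k \<omega>)))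
    \<le> exp (10 * sqrt (exp 1)
          * mixing_coeff A M Z f powr (real (P2 + Q2) / real (2 * P2 + 2 * Q2 + A ^ L))
          * (real (A ^ L) / real (P2 + Q2)))
      * exp (4 * \<beta>\<^sup>2 * exp 1 * (real P2)\<^sup>2 * variance_bound P * (real (A ^ L) / real (P2 + Q2) + 1))"
    (is "?E \<le> exp ?m * exp ?v")
proof -
  define \<alpha> where "\<alpha> = mixing_coeff A M Z f"
  define x where "x = real (A ^ L) / real (P2 + Q2)"
  define c where "c = 10 * sqrt (exp 1 :: real)"
  have \<alpha>01: "0 \<le> \<alpha>" "\<alpha> \<le> 1" unfolding \<alpha>_def by (rule mixing_coeff_nonneg mixing_coeff_le_1)+
  have P2: "P2 \<ge> 1" using Q2 by simp
  have AP: "real A ^ P - 1 > 0" using A P by simp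
  have x0: "x \<ge> 0" by (simp add: x_def)
  have Rx: "real (R - 1) \<le> x"
  proof -
    have "real (R - 1) \<le> real (A ^ L - 1) / real (P2 + Q2)"
      unfolding R using of_nat_div_le_of_nat[of "A ^ L - 1" "P2 + Q2"] by simp
    also have "\<dots> \<le> x" unfolding x_def by (intro divide_right_mono) auto
    finally show ?thesis .
  qed
  have small: "\<bar>\<delta>\<bar> * (real P2 * (C * ((real A ^ P - 1) / (real A - 1)))) \<le> 1 / 2"
  proof -
    define u where "u = real P2 * (C * ((real A ^ P - 1) / (real A - 1)))"
    have u: "u > 0" unfolding u_def using P2 \<open>C > 0\<close> AP A by simp
    have "(real A - 1) / (4 * exp 1 * C * real P2 * (real A ^ P - 1)) = 1 / (4 * exp 1 * u)"
      unfolding u_def using A by (simp add: field_simps)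
    then have "\<beta> * u \<le> 1 / (4 * exp 1 * u) * u" using \<beta>(2) u by (intro mult_right_mono) auto
    also have "\<dots> = 1 / (4 * exp 1)" using u by simp
    also have "\<dots> \<le> 1 / 4" using exp_ge_add_one_self[of "1::real"] by (simp add: field_simps)
    finally show ?thesis unfolding \<delta> u_def[symmetric] by simp
  qed
  have "?E \<le> exp (real R * (\<delta>\<^sup>2 * (real P2)\<^sup>2 * variance_bound P)
        + real (R - 1) * (10 * sqrt (exp 1) * \<alpha> powr (1 / real (R + 1))))"
  proof (rule block_exp_moment[OF P Q2(1)])
    show "blocks (A ^ L) (P2 + Q2) {a..<b} i \<subseteq> {1..A ^ L}" for i by (auto simp: blocks_def)
    show "card (blocks (A ^ L) (P2 + Q2) {a..<b} i) \<le> P2" for i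
      using card_blocks[of "{a..<b}" "A ^ L" "P2 + Q2" i] W(1) by simp
    show "k + Q2 < k'" if "i < j" "k \<in> blocks (A ^ L) (P2 + Q2) {a..<b} i"
      "k' \<in> blocks (A ^ L) (P2 + Q2) {a..<b} j" for i j k k'
      using blocks_gap that W(2) by blast
  qed (use small R f in \<open>auto simp: \<alpha>_def\<close>)
  also have "\<dots> \<le> exp (?m + ?v)"
    unfolding exp_le_cancel_iff
  proof (subst add.commute, rule add_mono)
    have "real (R - 1) * (c * \<alpha> powr (1 / real (R + 1)))
        \<le> x * (c * \<alpha> powr (real (P2 + Q2) / real (2 * P2 + 2 * Q2 + A ^ L)))"
    proof (intro mult_mono mult_left_mono)
      have "real (P2 + Q2) / real (2 * P2 + 2 * Q2 + A ^ L) = 1 / (x + 2)"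
        using P2 by (simp add: x_def field_simps)
      also have "\<dots> \<le> 1 / real (R + 1)"
        using Rx by (intro divide_left_mono) (auto simp: R)
      finally show "\<alpha> powr (1 / real (R + 1)) \<le> \<alpha> powr (real (P2 + Q2) / real (2 * P2 + 2 * Q2 + A ^ L))"
        using \<alpha>01 by (cases "\<alpha> = 0") (auto intro: powr_mono')
    qed (use Rx x0 in \<open>auto simp: c_def\<close>)
    then show "real (R - 1) * (10 * sqrt (exp 1) * \<alpha> powr (1 / real (R + 1))) \<le> ?m"
      by (simp add: c_def x_def \<alpha>_def mult_ac)
    have "real R * (4 * \<beta>\<^sup>2 * 1 * ((real P2)\<^sup>2 * variance_bound P))
        \<le> (x + 1) * (4 * \<beta>\<^sup>2 * exp 1 * ((real P2)\<^sup>2 * variance_bound P))"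
      using Rx x0 variance_bound_nonneg[of P]
      by (intro mult_mono mult_left_mono) (auto simp: R)
    moreover have "\<delta>\<^sup>2 = 4 * \<beta>\<^sup>2"
      using arg_cong[OF \<delta>, of "\<lambda>t. t\<^sup>2"] by (simp add: power_mult_distrib)
    ultimately show "real R * (\<delta>\<^sup>2 * (real P2)\<^sup>2 * variance_bound P) \<le> ?v"
      by (simp add: x_def mult_ac)
  qed
  finally show ?thesis by (simp add: exp_add)
qed

text \<open>The offsets below \<open>P2\<close> form the long blocks and the remaining ones the short blocks.  Either kind
is separated by the other, and \<open>Q2 \<le> P2\<close> makes \<open>Q2\<close> a lower bound for both gaps.  The
two halves \<open>S U\<close> and \<open>S V\<close> are strongly dependent on each other, so the exponential of the sum
is decoupled by the arithmetic-geometric mean inequality; this is what doubles \<open>\<beta>\<close> in the moments.\<close>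
lemma Bernstein_inequality:
  fixes \<beta> \<epsilon> :: real and P P2 Q2 f L :: nat
  assumes P: "P \<ge> 1" and Q2: "Q2 \<ge> 1" "Q2 \<le> P2" and N: "P2 + Q2 < A ^ L"
    and \<beta>: "0 < \<beta>" "\<beta> \<le> (real A - 1) / (4 * exp 1 * C * real P2 * (real A ^ P - 1))" and C: "C > 0"
    and f: "f = 2 * nat \<lceil>ln (real Q2) / ln (real A)\<rceil>"
  shows "\<P>(\<omega> in M. \<bar>\<Sum>v\<in>(\<Union>k\<in>{1..A ^ L}. subtree A L k P). Z v \<omega>\<bar> > \<epsilon>)
    \<le> 2 * exp (- \<beta> * \<epsilon>)
      * exp (10 * sqrt (exp 1)
          * mixing_coeff A M Z f powr (real (P2 + Q2) / real (2 * P2 + 2 * Q2 + A ^ L))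
          * (real (A ^ L) / real (P2 + Q2)))
      * exp (4 * \<beta>\<^sup>2 * exp 1 * (real P2)\<^sup>2 * variance_bound P * (real (A ^ L) / real (P2 + Q2) + 1))"
    (is "_ \<le> 2 * exp (- \<beta> * \<epsilon>) * ?B1 * ?B2")
proof -
  define q where "q = P2 + Q2"
  define R where "R = Suc ((A ^ L - 1) div q)"
  define S where "S W \<omega> = (\<Sum>i<R. \<Sum>k\<in>blocks (A ^ L) q W i. subtree_sum L P k \<omega>)" for W \<omega>
  define U V where "U = {0..<P2}" and "V = {P2..<q}"
  define T where "T \<omega> = (\<Sum>v\<in>(\<Union>k\<in>{1..A ^ L}. subtree A L k P). Z v \<omega>)" for \<omega>
  define E where "E \<delta> W = expectation (\<lambda>\<omega>. exp (\<delta> * S W \<omega>))" for \<delta> W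
  have T: "T \<omega> = S U \<omega> + S V \<omega>" for \<omega>
    unfolding T_def sum_generation_eq[OF P] S_def U_def V_def R_def
    using Q2 by (intro sum_blocks) (auto simp: q_def)
  define B where "B = ?B1 * ?B2"
  have E: "E \<delta> W \<le> B" if "\<bar>\<delta>\<bar> = 2 * \<beta>" "W \<in> {U, V}" for \<delta> W
    using that(2) unfolding E_def S_def U_def V_def q_def B_def
    using half_sum_exp_moment[OF P Q2 _ _ N \<beta> C that(1) f R_def[unfolded q_def]] Q2
    by auto
  have S_meas [measurable]: "S W \<in> borel_measurable M" for W
    unfolding S_def by measurable
  have T_meas [measurable]: "T \<in> borel_measurable M"
    unfolding T by measurable
  have int: "integrable M (\<lambda>\<omega>. exp (\<delta> * S W \<omega>))" for \<delta> W
  proof -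
    define K where "K = C * ((real A ^ P - 1) / (real A - 1))"
    have K: "AE \<omega> in M. \<forall>k\<in>{1..A ^ L}. \<bar>subtree_sum L P k \<omega>\<bar> \<le> K"
      unfolding K_def using P by (intro AE_finite_allI subtree_sum_bounded) (auto simp: nodes_def)
    define D where "D = (\<Sum>i<R. \<Sum>k\<in>blocks (A ^ L) q W i. K)"
    have "AE \<omega> in M. \<bar>exp (\<delta> * S W \<omega>)\<bar> \<le> exp (\<bar>\<delta>\<bar> * D)"
      using K
    proof eventually_elim
      case (elim \<omega>)
      have "\<bar>S W \<omega>\<bar> \<le> D"
        unfolding S_def D_def using elim
        by (intro order.trans[OF sum_abs] sum_mono) (auto simp: blocks_def)
      then have "\<bar>\<delta> * S W \<omega>\<bar> \<le> \<bar>\<delta>\<bar> * D"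
        unfolding abs_mult by (intro mult_left_mono) auto
      then show ?case by simp
    qed
    then show ?thesis by (intro integrable_AE_bounded) auto
  qed
  have exp_half: "exp (b * (s + t)) \<le> (exp (2 * b * s) + exp (2 * b * t)) / 2" for b s t :: real
  proof -
    have "0 \<le> (exp (b * s) - exp (b * t))\<^sup>2" by simp
    then show ?thesis
      by (simp add: power2_diff algebra_simps exp_add flip: exp_double)
  qed
  define g where "g \<omega> = exp (- \<beta> * \<epsilon>) * ((exp (2 * \<beta> * S U \<omega>) + exp (2 * \<beta> * S V \<omega>)) / 2
      + (exp (2 * - \<beta> * S U \<omega>) + exp (2 * - \<beta> * S V \<omega>)) / 2)" for \<omega>
  have Markov: "indicator {\<omega> \<in> space M. \<bar>T \<omega>\<bar> > \<epsilon>} \<omega> \<le> g \<omega>" for \<omega>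
  proof (cases "\<bar>T \<omega>\<bar> > \<epsilon>")
    case True
    have "1 \<le> exp (\<beta> * (\<bar>T \<omega>\<bar> - \<epsilon>))" using True \<beta>(1) by simp
    also have "\<dots> = exp (- \<beta> * \<epsilon>) * exp (\<beta> * \<bar>T \<omega>\<bar>)"
      by (simp add: algebra_simps flip: exp_add)
    also have "\<dots> \<le> exp (- \<beta> * \<epsilon>) * (exp (\<beta> * T \<omega>) + exp (- \<beta> * T \<omega>))"
      by (intro mult_left_mono) (auto simp: abs_if)
    also have "\<dots> \<le> g \<omega>"
      unfolding g_def T by (intro mult_left_mono add_mono exp_half) auto
    finally show ?thesis by (simp add: indicator_def)
  qed (auto simp: g_def intro!: mult_nonneg_nonneg add_nonneg_nonneg)
  have "\<P>(\<omega> in M. \<bar>T \<omega>\<bar> > \<epsilon>) = expectation (indicator {\<omega> \<in> space M. \<bar>T \<omega>\<bar> > \<epsilon>})"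
    by simp
  also have "\<dots> \<le> expectation g"
  proof (rule integral_mono)
    show "integrable M g" unfolding g_def
      by (intro integrable_mult_right Bochner_Integration.integrable_add integrable_divide int)
    show "integrable M (indicat_real {\<omega> \<in> space M. \<bar>T \<omega>\<bar> > \<epsilon>})"
      by (intro integrable_real_indicator) (auto simp: emeasure_eq_measure)
  qed (rule Markov)
  also have "\<dots> = exp (- \<beta> * \<epsilon>) * ((E (2 * \<beta>) U + E (2 * \<beta>) V) / 2 + (E (2 * - \<beta>) U + E (2 * - \<beta>) V) / 2)"
    unfolding g_def E_def using int[of "2 * \<beta>"] int[of "2 * - \<beta>"] by simp
  also have "\<dots> \<le> exp (- \<beta> * \<epsilon>) * (2 * B)"
  proof (rule mult_left_mono)
    have mean: "(a + b) / 2 + (c + d) / 2 \<le> 2 * B" if "a \<le> B" "b \<le> B" "c \<le> B" "d \<le> B"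
      for a b c d :: real
      using add_mono[OF add_mono[OF that(1,2)] add_mono[OF that(3,4)]] by (simp add: field_simps)
    show "(E (2 * \<beta>) U + E (2 * \<beta>) V) / 2 + (E (2 * - \<beta>) U + E (2 * - \<beta>) V) / 2 \<le> 2 * B"
      by (intro mean E) (use \<beta>(1) in auto)
  qed simp
  finally show ?thesis by (simp add: T_def B_def mult_ac)
qed

end

theorem theorem2p2:
  fixes M :: "'a measure"
    and Z :: "nat \<times> nat \<Rightarrow> 'a \<Rightarrow> real"
    and A L P P2 Q2 f :: nat
    and C \<sigma> \<beta> \<epsilon> :: real
  assumes "A \<ge> 1"
    and "prob_space M"
    and "\<And>v. v \<in> nodes A \<Longrightarrow> Z v \<in> borel_measurable M"
    and "\<And>v. v \<in> nodes A \<Longrightarrow> prob_space.expectation M (Z v) = 0"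
    and "C > 0" and "\<sigma> > 0"
    and "\<And>v. v \<in> nodes A \<Longrightarrow> esssup M (\<lambda>\<omega>. ereal \<bar>Z v \<omega>\<bar>) \<le> ereal C"
    and "\<And>v. v \<in> nodes A \<Longrightarrow> prob_space.variance M (Z v) \<le> \<sigma>\<^sup>2"
    and "P \<ge> 1" and "P2 \<ge> 1" and "Q2 \<ge> 1"
    and "Q2 \<le> P2" and "P2 + Q2 < A ^ L"
    and "0 < \<beta>"
    and "\<beta> \<le> (real A - 1) / (4 * exp 1 * C * real P2 * (real A ^ P - 1))"
    and "f = 2 * nat \<lceil>ln (real Q2) / ln (real A)\<rceil>"
    and "\<epsilon> > 0"
  shows "\<P>(\<omega> in M. \<bar>\<Sum>v\<in>(\<Union>k\<in>{1..A ^ L}. subtree A L k P). Z v \<omega>\<bar> > \<epsilon>)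
    \<le> 2 * exp (- \<beta> * \<epsilon>)
      * exp (10 * sqrt (exp 1)
          * mixing_coeff A M Z f powr (real (P2 + Q2) / real (2 * P2 + 2 * Q2 + A ^ L))
          * (real (A ^ L) / real (P2 + Q2)))
      * exp (4 * \<beta>\<^sup>2 * exp 1 * (real P2)\<^sup>2
          * ((real A ^ P - 1) / (real A - 1) * \<sigma>\<^sup>2
             + 4 * C\<^sup>2 * (\<Sum>k=1..2 * (P - 1). mixing_coeff A M Z k * real (pair_count A P k)))
          * (real (A ^ L) / real (P2 + Q2) + 1))"
proof -
  interpret prob_space M by (rule assms(2))
  \<comment> \<open>For \<open>A = 1\<close> there is only one subtree and no room for \<open>P2 + Q2\<close> of them.\<close>
  have "A \<noteq> 1"
    using assms(10,13) by auto
  then have A2: "A \<ge> 2" using assms(1) by simp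
  interpret bounded_tree_field M Z A C \<sigma>
  proof unfold_locales
    show "A \<ge> 2" by (rule A2)
    fix v assume v: "v \<in> nodes A"
    show "Z v \<in> borel_measurable M" "expectation (Z v) = 0" using assms(3,4) v by auto
    show "AE \<omega> in M. \<bar>Z v \<omega>\<bar> \<le> C"
      using esssup_AE[of "\<lambda>\<omega>. ereal \<bar>Z v \<omega>\<bar>" M]
    proof eventually_elim
      case (elim \<omega>)
      then have "ereal \<bar>Z v \<omega>\<bar> \<le> ereal C" using assms(7)[OF v] by (rule order.trans)
      then show ?case by simp
    qed
    show "expectation (\<lambda>\<omega>. (Z v \<omega>)\<^sup>2) \<le> \<sigma>\<^sup>2"
      using assms(4,8)[OF v] by simp
  qed (use assms(5) in auto)
  show ?thesis
    using Bernstein_inequality[OF assms(9,11,12,13,14,15,5,16)] unfolding variance_bound_def .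
qed

end
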